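(* Let $(X,Z,\mu)$ be a separated $G$-transverse system with return time set $\Lambda(Z)$, and let $(X,Y,\mu)$, $Y=H.Z$, be the induced $(G,H)$-transverse system. (i) If there is a compatible pair $(H,\Lambda)$ with $\Lambda(Z)\subset\Lambda$, then $(X,Y,\mu)$ is integrable. (ii) If $(H,\Lambda)$ can moreover be chosen to be uniform, then $(X,Y,\mu)$ is $p$-integrable for all $p\in[1,\infty]$.
   Context: $G$ is a unimodular lcsc group, $H<G$ a closed unimodular subgroup, $X$ a standard Borel $G$-space, $\mu$ a $G$-invariant Borel probability measure on $X$. A $G$-cross section is a Borel subset $Z\subset X$ with $G.Z=X$; put $Z_x=\{g\in G\mid g.x\in Z\}$ and $\Lambda(Z)=\bigcup_{z\in Z}Z_z\subset G$ (return time set). $Z$ is separated if $\Lambda(Z)$ does not accumulate at the identity $e_G$; then $(X,Z,\mu)$ is called a separated $G$-transverse system. In this case $Y=H.Z$ is a Borel $H$-invariant set with $G.Y=X$, and its hitting time sets are $Y_x=\{Hg\in H\backslash G\mid g.x\in Y\}$. $(X,Y,\mu)$ is $p$-integrable if $\int_X|Y_x\cap L|^p\,d\mu(x)<\infty$ for every compact $L\subset H\backslash G$ (for $p=\infty$: $x\mapsto|Y_x\cap L|$ is $\mu$-essentially bounded); integrable means $1$-integrable. Let $\Lambda\subset G$ be symmetric and contain the identity. $\Lambda$ has finite covolume if $G=\Lambda\mathcal F$ for some $\mathcal F\subset G$ of finite Haar measure, and is relatively dense if $G=\Lambda\mathcal F$ for some compact $\mathcal F$. $\Lambda$ is an approximate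 subgroup if $\Lambda\Lambda\subset\Lambda F$ for some finite $F\subset G$. An approximate lattice is a discrete approximate subgroup of finite covolume; it is uniform if moreover relatively dense. $(H,\Lambda)$ is a (uniform) compatible pair if $\Lambda\subset G$ and $\Lambda\cap H\subset H$ are both (uniform) approximate lattices. *)

theory Defs
  imports "HOL-Probability.Probability" "HOL-Library.Set_Algebras"
begin

text \<open>
  Groups are written additively because the library's class of topological groups is
  \<^class>\<open>topological_group_add\<close>; this class does not assume commutativity, and the order of
  summands matters throughout.  So \<open>a + b\<close> is the product of \<open>a\<close> and \<open>b\<close>, \<open>0\<close> is the identity,
  and \<open>A + B\<close> is the product set of \<open>A\<close> and \<open>B\<close> (\<^theory>\<open>HOL-Library.Set_Algebras\<close>).
  The lcsc group is a type \<open>'g\<close>; it and its closed subgroup \<open>H\<close> are treated uniformly, by notions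
  that are relative to a closed subgroup \<open>S\<close> of \<open>'g\<close>, with \<open>S = UNIV\<close> for the whole group.
\<close>

definition closed_subgroup :: "'g::topological_group_add set \<Rightarrow> bool" where
  "closed_subgroup S \<longleftrightarrow>
     closed S \<and> 0 \<in> S \<and> (\<forall>a\<in>S. \<forall>b\<in>S. a + b \<in> S) \<and> (\<forall>a\<in>S. - a \<in> S)"


subsection \<open>Haar measure and unimodularity\<close>

text \<open>Borel measures that are finite on compact sets are Radon on an lcsc group, so regularity
  need not be required.\<close>

definition left_haar_measure :: "'g::topological_group_add set \<Rightarrow> 'g measure \<Rightarrow> bool" where
  "left_haar_measure S m \<longleftrightarrow>
     sets m = sets (restrict_space borel S) \<and>
     (\<forall>K. K \<subseteq> S \<and> compact K \<longrightarrow> emeasure m K < \<infinity>) \<and>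
     emeasure m S \<noteq> 0 \<and>
     (\<forall>s\<in>S. \<forall>A\<in>sets m. emeasure m ((\<lambda>a. s + a) ` A) = emeasure m A)"

definition unimodular :: "'g::topological_group_add set \<Rightarrow> bool" where
  "unimodular S \<longleftrightarrow>
     (\<forall>m. left_haar_measure S m \<longrightarrow>
       (\<forall>s\<in>S. \<forall>A\<in>sets m. emeasure m ((\<lambda>a. a + s) ` A) = emeasure m A))"


subsection \<open>Approximate lattices\<close>

definition approximate_subgroup :: "'g::topological_group_add set \<Rightarrow> 'g set \<Rightarrow> bool" where
  "approximate_subgroup S \<Lambda> \<longleftrightarrow>
     \<Lambda> \<subseteq> S \<and> 0 \<in> \<Lambda> \<and> uminus ` \<Lambda> = \<Lambda> \<and> (\<exists>F\<subseteq>S. finite F \<and> \<Lambda> + \<Lambda> \<subseteq> \<Lambda> + F)"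

text \<open>Discreteness of an approximate subgroup means that it accumulates nowhere in the group, i.e.
  that it meets every compact set in a finite set.  This is the usual convention for approximate
  lattices.  For subgroups it agrees with discreteness of the subspace topology.\<close>

definition nowhere_accumulating :: "'g::topological_space set \<Rightarrow> bool" where
  "nowhere_accumulating \<Lambda> \<longleftrightarrow> (\<forall>g. \<not> g islimpt \<Lambda>)"

text \<open>Haar measures are unique up to scaling, so the choice of \<open>m\<close> is immaterial.\<close>

definition finite_covolume :: "'g::topological_group_add set \<Rightarrow> 'g set \<Rightarrow> bool" where
  "finite_covolume S \<Lambda> \<longleftrightarrow>
     (\<exists>m F. left_haar_measure S m \<and> F \<in> sets m \<and> emeasure m F < \<infinity> \<and> S = \<Lambda> + F)"

definition relatively_dense :: "'g::topological_group_add set \<Rightarrow> 'g set \<Rightarrow> bool" where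
  "relatively_dense S \<Lambda> \<longleftrightarrow> (\<exists>F\<subseteq>S. compact F \<and> S = \<Lambda> + F)"

definition approximate_lattice :: "'g::topological_group_add set \<Rightarrow> 'g set \<Rightarrow> bool" where
  "approximate_lattice S \<Lambda> \<longleftrightarrow>
     approximate_subgroup S \<Lambda> \<and> nowhere_accumulating \<Lambda> \<and> finite_covolume S \<Lambda>"

definition uniform_approximate_lattice :: "'g::topological_group_add set \<Rightarrow> 'g set \<Rightarrow> bool" where
  "uniform_approximate_lattice S \<Lambda> \<longleftrightarrow> approximate_lattice S \<Lambda> \<and> relatively_dense S \<Lambda>"

definition compatible_pair :: "'g::topological_group_add set \<Rightarrow> 'g set \<Rightarrow> bool" where
  "compatible_pair H \<Lambda> \<longleftrightarrow> approximate_lattice UNIV \<Lambda> \<and> approximate_lattice H (\<Lambda> \<inter> H)"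

definition uniform_compatible_pair :: "'g::topological_group_add set \<Rightarrow> 'g set \<Rightarrow> bool" where
  "uniform_compatible_pair H \<Lambda> \<longleftrightarrow>
     uniform_approximate_lattice UNIV \<Lambda> \<and> uniform_approximate_lattice H (\<Lambda> \<inter> H)"


subsection \<open>Transverse systems\<close>

text \<open>A standard Borel space is the Borel space of a Polish topology on the underlying set.\<close>

definition standard_borel :: "'x measure \<Rightarrow> bool" where
  "standard_borel M \<longleftrightarrow>
     (\<exists>T. completely_metrizable_space T \<and> second_countable T \<and> topspace T = space M \<and>
          sets M = sigma_sets (topspace T) {U. openin T U})"

definition borel_action :: "('g::topological_group_add \<Rightarrow> 'x \<Rightarrow> 'x) \<Rightarrow> 'x measure \<Rightarrow> bool" where
  "borel_action act M \<longleftrightarrow>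
     (\<lambda>(g, x). act g x) \<in> (borel \<Otimes>\<^sub>M M) \<rightarrow>\<^sub>M M \<and>
     (\<forall>x\<in>space M. act 0 x = x) \<and>
     (\<forall>g h. \<forall>x\<in>space M. act (g + h) x = act g (act h x))"

definition saturation :: "('g \<Rightarrow> 'x \<Rightarrow> 'x) \<Rightarrow> 'g set \<Rightarrow> 'x set \<Rightarrow> 'x set" where
  "saturation act S Z = {act s z | s z. s \<in> S \<and> z \<in> Z}"

definition return_times :: "('g \<Rightarrow> 'x \<Rightarrow> 'x) \<Rightarrow> 'x set \<Rightarrow> 'g set" where
  "return_times act Z = (\<Union>z\<in>Z. {g. act g z \<in> Z})"

text \<open>The measurable structure of the space is carried by the measure \<open>\<mu>\<close>.\<close>

definition separated_transverse_system ::
    "('g::topological_group_add \<Rightarrow> 'x \<Rightarrow> 'x) \<Rightarrow> 'x set \<Rightarrow> 'x measure \<Rightarrow> bool" where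
  "separated_transverse_system act Z \<mu> \<longleftrightarrow>
     standard_borel \<mu> \<and> borel_action act \<mu> \<and>
     prob_space \<mu> \<and> (\<forall>g. distr \<mu> \<mu> (act g) = \<mu>) \<and>
     Z \<in> sets \<mu> \<and> saturation act UNIV Z = space \<mu> \<and>
     \<not> 0 islimpt return_times act Z"


subsection \<open>The coset space and integrability\<close>

definition coset :: "'g::plus set \<Rightarrow> 'g \<Rightarrow> 'g set" where
  "coset H g = (\<lambda>h. h + g) ` H"

definition coset_topology :: "'g::topological_group_add set \<Rightarrow> 'g set topology" where
  "coset_topology H = topology (\<lambda>U. U \<subseteq> range (coset H) \<and> open (coset H -` U))"

lemma openin_coset_topology:
  "openin (coset_topology H) U \<longleftrightarrow> U \<subseteq> range (coset H) \<and> open (coset H -` U)"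
proof -
  have "istopology (\<lambda>U. U \<subseteq> range (coset H) \<and> open (coset H -` U))"
    unfolding istopology_def by (auto simp: vimage_Union intro!: open_UN)
  then show ?thesis
    by (simp add: coset_topology_def topology_inverse')
qed

lemma topspace_coset_topology: "topspace (coset_topology H) = range (coset H)"
proof
  show "topspace (coset_topology H) \<subseteq> range (coset H)"
    using openin_topspace openin_coset_topology by blast
  show "range (coset H) \<subseteq> topspace (coset_topology H)"
    by (rule openin_subset) (simp add: openin_coset_topology vimage_def)
qed

lemma quotient_map_coset: "quotient_map euclidean (coset_topology H) (coset H)"
  by (auto simp: quotient_map_def topspace_coset_topology openin_coset_topology vimage_def)

definition hitting_times ::
    "('g::topological_group_add \<Rightarrow> 'x \<Rightarrow> 'x) \<Rightarrow> 'g set \<Rightarrow> 'x set \<Rightarrow> 'x \<Rightarrow> 'g set set" where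
  "hitting_times act H Y x = {coset H g | g. act g x \<in> Y}"

definition cardinality_power :: "'a set \<Rightarrow> real \<Rightarrow> ennreal" where
  "cardinality_power A p = (if finite A then ennreal (real (card A) powr p) else \<infinity>)"

text \<open>If \<open>Y\<close> is induced by a separated cross section, the function
  \<open>x \<mapsto> |Y\<^sub>x \<inter> L|\<close> is Borel for compact \<open>L\<close>, by the Lusin-Novikov theorem applied to
  the countable sets \<open>{g. act g x \<in> Z}\<close>; so the integral below is the usual one.\<close>

definition transverse_integrable ::
    "('g::topological_group_add \<Rightarrow> 'x \<Rightarrow> 'x) \<Rightarrow> 'g set \<Rightarrow> 'x set \<Rightarrow> 'x measure \<Rightarrow> ennreal \<Rightarrow> bool"
where
  "transverse_integrable act H Y \<mu> p \<longleftrightarrow>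
     (\<forall>L. compactin (coset_topology H) L \<longrightarrow>
       (if p = \<infinity>
        then \<exists>C::nat. AE x in \<mu>. finite (hitting_times act H Y x \<inter> L) \<and>
                              card (hitting_times act H Y x \<inter> L) \<le> C
        else (\<integral>\<^sup>+ x. cardinality_power (hitting_times act H Y x \<inter> L) (enn2real p) \<partial>\<mu>) < \<infinity>))"

end

theory Submission
  imports Defs
begin

text \<open>
  Put \<open>\<Gamma> = \<Lambda> \<inter> H\<close> and, for a point \<open>x\<close>, let \<open>V\<^sub>x\<close> be the set of all \<open>g\<close> with
  \<open>g.x \<in> \<Gamma>.Z\<close>.  Differences of elements of \<open>V\<^sub>x\<close> lie in the threefold product of \<open>\<Lambda>\<close>, which is
  locally finite; so \<open>V\<^sub>x\<close> meets a compact set in boundedly many points, uniformly in \<open>x\<close>.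

  If \<open>H = \<Gamma> C\<close> with \<open>C\<close> compact, then every coset of \<open>Y\<^sub>x\<close> that meets a compact set \<open>K\<close> has a
  representative in \<open>V\<^sub>x \<inter> C K\<close>, which gives (ii).  If \<open>H = \<Gamma> F\<close> with \<open>F\<close> of finite Haar measure,
  fix a compact \<open>C \<subseteq> H\<close> of positive measure and put \<open>K' = C\<^sup>-\<^sup>1 K\<close>.  Each coset of \<open>Y\<^sub>x\<close> meeting \<open>K\<close>
  contributes at least \<open>m(C)\<close> to the sum over \<open>g \<in> V\<^sub>x\<close> of the measure of all \<open>f \<in> F\<close> with
  \<open>f\<^sup>-\<^sup>1 g \<in> K'\<close>.  The intensity \<open>\<eta>(B) = \<integral> |V\<^sub>x \<inter> B| d\<mu>(x)\<close> is a right-invariant measure, finite on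
  compact sets, hence left-invariant as the group is unimodular; so that sum has integral
  \<open>m(F) \<eta>(K') < \<infinity>\<close>, which gives (i).

  That \<open>|V\<^sub>x \<inter> B|\<close> depends measurably on \<open>x\<close>, up to null sets, is an instance of the measurable
  projection theorem.
\<close>

subsection \<open>Souslin schemes\<close>

text \<open>A finite sequence of length \<open>k\<close> is represented by any infinite sequence
  extending it, which is why level \<open>k\<close> may depend on the first \<open>k\<close> entries
  only. Only the group factor carries a topology: closed sets there feed a compactness argument,
  while measurable sets suffice in the other factor.\<close>

definition souslin_scheme ::
    "'x measure \<Rightarrow> (nat \<Rightarrow> (nat \<Rightarrow> nat) \<Rightarrow> 'g::topological_space set) \<Rightarrow>
      (nat \<Rightarrow> (nat \<Rightarrow> nat) \<Rightarrow> 'x set) \<Rightarrow> bool" where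
  "souslin_scheme M U A \<longleftrightarrow>
     (\<forall>k a. closed (U k a) \<and> A k a \<in> sets M) \<and>
     (\<forall>k a b. (\<forall>i<k. a i = b i) \<longrightarrow> U k a = U k b \<and> A k a = A k b)"

definition souslin :: "'x measure \<Rightarrow> ('g::topological_space \<times> 'x) set \<Rightarrow> bool" where
  "souslin M E \<longleftrightarrow>
     (\<exists>U A. souslin_scheme M U A \<and> E = (\<Union>a. \<Inter>k. U k a \<times> A k a))"

lemma mem_UN_INT_iff: "p \<in> (\<Union>a. \<Inter>k. R k a) \<longleftrightarrow> (\<exists>a. \<forall>k. p \<in> R k a)"
  by blast

lemma souslin_rectangle:
  assumes "closed C" "B \<in> sets M"
  shows "souslin M (C \<times> B)"
  unfolding souslin_def
  by (rule exI[of _ "\<lambda>_ _. C"], rule exI[of _ "\<lambda>_ _. B"]) (use assms in \<open>auto simp: souslin_scheme_def\<close>)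

lemma souslin_family:
  fixes E :: "'i \<Rightarrow> ('g::topological_space \<times> 'x) set"
  assumes "\<And>n. souslin M (E n)"
  shows "\<exists>U A. \<forall>n. souslin_scheme M (U n) (A n) \<and> E n = (\<Union>a. \<Inter>k. U n k a \<times> A n k a)"
proof -
  have "\<forall>n. \<exists>U A. souslin_scheme M U A \<and> E n = (\<Union>a. \<Inter>k. U k a \<times> A k a)"
    using assms unfolding souslin_def by blast
  then have "\<exists>U. \<forall>n. \<exists>A. souslin_scheme M (U n) A \<and> E n = (\<Union>a. \<Inter>k. U n k a \<times> A k a)"
    by (rule choice)
  then obtain U where
    "\<forall>n. \<exists>A. souslin_scheme M (U n) A \<and> E n = (\<Union>a. \<Inter>k. U n k a \<times> A k a)"
    by blast
  then have "\<exists>A. \<forall>n. souslin_scheme M (U n) (A n) \<and> E n = (\<Union>a. \<Inter>k. U n k a \<times> A n k a)"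
    by (rule choice)
  then show ?thesis
    by blast
qed

text \<open>The first entry of a sequence selects one of the sets, and the remaining entries run
  through the scheme of that set.\<close>

lemma souslin_UN:
  fixes E :: "nat \<Rightarrow> ('g::topological_space \<times> 'x) set"
  assumes "\<And>n. souslin M (E n)"
  shows "souslin M (\<Union>n. E n)"
proof -
  obtain U A where sch: "\<And>n. souslin_scheme M (U n) (A n)"
    and E: "\<And>n. E n = (\<Union>a. \<Inter>k. U n k a \<times> A n k a)"
    using souslin_family[of M E, OF assms] by (elim exE) blast
  \<comment> \<open>Level 0 may not look at any entry, so it imposes no restriction; level
    \<open>Suc j\<close> reads the selector and \<open>j\<close> further entries.\<close>
  define U' where "U' k a = (case k of 0 \<Rightarrow> UNIV | Suc j \<Rightarrow> U (a 0) j (\<lambda>i. a (Suc i)))" for k a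
  define A' where "A' k a = (case k of 0 \<Rightarrow> space M | Suc j \<Rightarrow> A (a 0) j (\<lambda>i. a (Suc i)))" for k a
  have dep: "U n j a = U n j b \<and> A n j a = A n j b" if "\<forall>i<j. a i = b i" for n j a b
    using sch[of n, unfolded souslin_scheme_def, THEN conjunct2, rule_format, of j a b] that by blast
  have A_sets: "A n k a \<in> sets M" for n k a
    using sch[of n] unfolding souslin_scheme_def by simp
  have "souslin_scheme M U' A'"
    unfolding souslin_scheme_def
  proof (intro conjI allI impI)
    fix k :: nat and a b :: "nat \<Rightarrow> nat" assume eq: "\<forall>i<k. a i = b i"
    have *: "a 0 = b 0 \<and> (\<forall>i<j. a (Suc i) = b (Suc i))" if "k = Suc j" for j
      using eq that by auto
    show "U' k a = U' k b" "A' k a = A' k b"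
      using * dep[of _ "\<lambda>i. a (Suc i)" "\<lambda>i. b (Suc i)"]
      by (auto simp: U'_def A'_def split: nat.split)
  qed (use sch in \<open>auto simp: U'_def A'_def souslin_scheme_def split: nat.split\<close>)
  moreover have "(\<Union>n. E n) = (\<Union>a. \<Inter>k. U' k a \<times> A' k a)"
  proof (intro subset_antisym subsetI)
    fix p assume "p \<in> (\<Union>n. E n)"
    then have "\<exists>n a. \<forall>k. p \<in> U n k a \<times> A n k a"
      by (simp only: E UN_iff INT_iff bex_UNIV ball_UNIV)
    then obtain n a where p: "\<And>k. p \<in> U n k a \<times> A n k a"
      by (elim exE) (rule that, erule spec)
    have "snd p \<in> space M"
      using subsetD[OF sets.sets_into_space[OF A_sets], of "snd p" n 0 a] p[of 0]
      by (simp add: mem_Times_iff)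
    then have "p \<in> U' k (case_nat n a) \<times> A' k (case_nat n a)" for k
      using p by (cases k) (simp_all add: U'_def A'_def mem_Times_iff)
    then show "p \<in> (\<Union>a. \<Inter>k. U' k a \<times> A' k a)"
      unfolding mem_UN_INT_iff by (intro exI allI)
  next
    fix p assume "p \<in> (\<Union>a. \<Inter>k. U' k a \<times> A' k a)"
    then obtain a where a: "\<And>k. p \<in> U' k a \<times> A' k a"
      unfolding mem_UN_INT_iff by (elim exE) (rule that, erule spec)
    have "p \<in> U (a 0) k (\<lambda>i. a (Suc i)) \<times> A (a 0) k (\<lambda>i. a (Suc i))" for k
      using a[of "Suc k"] by (simp add: U'_def A'_def)
    then show "p \<in> (\<Union>n. E n)"
      by (simp only: E UN_iff INT_iff bex_UNIV ball_UNIV) blast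
  qed
  ultimately show ?thesis
    unfolding souslin_def by blast
qed

text \<open>In \<open>souslin_INT\<close> this places the first \<open>k\<close> entries of row
  \<open>j\<close> among the first \<open>prod_encode (j, k)\<close> entries of the coded sequence.
  The pairing runs along diagonals, whose starting values \<open>triangle (j + i)\<close> increase
  with \<open>i\<close>.\<close>

lemma prod_encode_strict_mono: "i < k \<Longrightarrow> prod_encode (j, i) < prod_encode (j, k)"
proof -
  have "mono triangle"
    by (rule mono_iff_le_Suc[THEN iffD2]) simp
  moreover assume "i < k"
  ultimately have "triangle (Suc (j + i)) \<le> triangle (j + k)"
    by (intro monoD[of triangle]) auto
  then show ?thesis
    by (simp add: prod_encode_def)
qed

text \<open>A point of the intersection comes with one sequence for each set; the pairing function
  codes these sequences as the rows of a single one. Stage \<open>prod_encode (j, k)\<close> of the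
  combined scheme is stage \<open>k\<close> of the scheme of \<open>E j\<close>, run along row
  \<open>j\<close>.\<close>

lemma souslin_INT:
  fixes E :: "nat \<Rightarrow> ('g::topological_space \<times> 'x) set"
  assumes "\<And>n. souslin M (E n)"
  shows "souslin M (\<Inter>n. E n)"
proof -
  obtain U A where sch: "\<And>n. souslin_scheme M (U n) (A n)"
    and E: "\<And>n. E n = (\<Union>a. \<Inter>k. U n k a \<times> A n k a)"
    using souslin_family[of M E, OF assms] by (elim exE) blast
  define row where "row a j = (\<lambda>i. a (prod_encode (j, i)))" for a :: "nat \<Rightarrow> nat" and j
  define U' where "U' n a = U (fst (prod_decode n)) (snd (prod_decode n)) (row a (fst (prod_decode n)))" for n a
  define A' where "A' n a = A (fst (prod_decode n)) (snd (prod_decode n)) (row a (fst (prod_decode n)))" for n a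
  have dep: "U n j a = U n j b \<and> A n j a = A n j b" if "\<forall>i<j. a i = b i" for n j a b
    using sch[of n, unfolded souslin_scheme_def, THEN conjunct2, rule_format, of j a b] that by blast
  have "souslin_scheme M U' A'"
    unfolding souslin_scheme_def
  proof (intro conjI allI impI)
    fix n :: nat and a b :: "nat \<Rightarrow> nat" assume eq: "\<forall>i<n. a i = b i"
    obtain j k where n: "n = prod_encode (j, k)"
      by (metis prod_decode_inverse surj_pair)
    have "\<forall>i<k. row a j i = row b j i"
      using eq prod_encode_strict_mono unfolding n row_def by blast
    from dep[OF this] show "U' n a = U' n b" "A' n a = A' n b"
      unfolding U'_def A'_def n by simp_all
  qed (use sch in \<open>auto simp: U'_def A'_def souslin_scheme_def\<close>)
  moreover have "(\<Inter>n. E n) = (\<Union>a. \<Inter>k. U' k a \<times> A' k a)"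
  proof (intro subset_antisym subsetI)
    fix p assume "p \<in> (\<Inter>n. E n)"
    then have "\<forall>n. \<exists>a. \<forall>k. p \<in> U n k a \<times> A n k a"
      by (simp only: E UN_iff INT_iff bex_UNIV ball_UNIV simp_thms)
    from choice[OF this] obtain c where c: "\<And>n k. p \<in> U n k (c n) \<times> A n k (c n)"
      by (elim exE) (rule that, drule spec, erule spec)
    define a where "a m = c (fst (prod_decode m)) (snd (prod_decode m))" for m
    have "row a j = c j" for j
      unfolding row_def a_def by simp
    then have "p \<in> U' k a \<times> A' k a" for k
      using c unfolding U'_def A'_def by simp
    then show "p \<in> (\<Union>a. \<Inter>k. U' k a \<times> A' k a)"
      unfolding mem_UN_INT_iff by (intro exI allI)
  next
    fix p assume "p \<in> (\<Union>a. \<Inter>k. U' k a \<times> A' k a)"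
    then obtain a where a: "\<And>n. p \<in> U' n a \<times> A' n a"
      unfolding mem_UN_INT_iff by (elim exE) (rule that, erule spec)
    have "p \<in> U j k (row a j) \<times> A j k (row a j)" for j k
      using a[of "prod_encode (j, k)"] by (simp add: U'_def A'_def)
    then show "p \<in> (\<Inter>n. E n)"
      by (simp only: E UN_iff INT_iff bex_UNIV ball_UNIV) blast
  qed
  ultimately show ?thesis
    unfolding souslin_def by blast
qed

lemma souslin_Un:
  assumes "souslin M E" "souslin M F"
  shows "souslin M (E \<union> F)"
proof -
  have "(\<Union>n::nat. if n = 0 then E else F) = E \<union> F"
    by (auto split: if_splits intro: exI[of _ "Suc 0"])
  then show ?thesis
    using souslin_UN[of M "\<lambda>n. if n = 0 then E else F"] assms by simp
qed

lemma souslin_Int: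
  assumes "souslin M E" "souslin M F"
  shows "souslin M (E \<inter> F)"
proof -
  have "(\<Inter>n::nat. if n = 0 then E else F) = E \<inter> F"
    by (auto split: if_splits)
  then show ?thesis
    using souslin_INT[of M "\<lambda>n. if n = 0 then E else F"] assms by simp
qed

text \<open>Souslin sets are in general not closed under complements, so the induction over the
  product sigma-algebra carries each set together with its complement. An open rectangle is Souslin
  because open sets are countable unions of closed ones; its complement is a union of two rectangles
  with closed first factor.\<close>

lemma souslin_measurable:
  fixes E :: "('g::topological_space \<times> 'x) set"
  assumes F_sigma: "\<And>W :: 'g set. open W \<Longrightarrow> \<exists>C. (\<forall>n::nat. closed (C n)) \<and> W = (\<Union>n. C n)"
    and "E \<in> sets ((borel :: 'g measure) \<Otimes>\<^sub>M M)"
  shows "souslin M E"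
proof -
  define good where "good S \<longleftrightarrow> souslin M S \<and> souslin M (UNIV \<times> space M - S)"
    for S :: "('g \<times> 'x) set"
  have compl: "good (UNIV \<times> space M - S)" if "good S" "S \<subseteq> UNIV \<times> space M" for S
    using that double_diff[of S "UNIV \<times> space M" "UNIV \<times> space M"] unfolding good_def by simp
  have union: "good (\<Union>n. S n)" if "\<And>n::nat. good (S n)" for S
  proof -
    have eq: "UNIV \<times> space M - (\<Union>n. S n) = (\<Inter>n. UNIV \<times> space M - S n)"
      by auto
    have "souslin M (S n)" "souslin M (UNIV \<times> space M - S n)" for n
      using that[of n] unfolding good_def by auto
    then show ?thesis
      unfolding good_def eq by (intro conjI souslin_UN souslin_INT)
  qed
  have rect_space: "souslin M (UNIV \<times> B)" if "B \<in> sets M" for B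
    using that by (intro souslin_rectangle) auto
  have good_rect: "good (V \<times> B)" if "V \<in> sets borel" and B: "B \<in> sets M" for V B
  proof -
    have "V \<in> sigma_sets UNIV {W. open W}"
      using that(1) by (simp add: borel_def)
    then show ?thesis
    proof induction
      case (Basic W)
      then obtain C where C: "\<And>n::nat. closed (C n)" "W = (\<Union>n. C n)"
        using F_sigma by blast
      have "(\<Union>n. C n \<times> B) = W \<times> B"
        using C(2) by blast
      then have "souslin M (W \<times> B)"
        using souslin_UN[of M "\<lambda>n. C n \<times> B"] souslin_rectangle[OF C(1) B] by simp
      moreover have "UNIV \<times> space M - W \<times> B = (- W) \<times> space M \<union> UNIV \<times> (space M - B)"
        using sets.sets_into_space[OF B] by blast
      moreover have "souslin M ((- W) \<times> space M)"
        using Basic by (intro souslin_rectangle) (auto simp: closed_def)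
      moreover have "souslin M (UNIV \<times> (space M - B))"
        using B by (intro rect_space) auto
      ultimately show ?case
        unfolding good_def by (simp only: simp_thms) (rule souslin_Un)
    next
      case (Compl V)
      have "(UNIV - V) \<times> B = (UNIV \<times> B) \<inter> (UNIV \<times> space M - V \<times> B)"
        using sets.sets_into_space[OF B] by blast
      moreover have "UNIV \<times> space M - (UNIV - V) \<times> B = V \<times> B \<union> UNIV \<times> (space M - B)"
        using sets.sets_into_space[OF B] by blast
      moreover have "souslin M (UNIV \<times> B)" "souslin M (UNIV \<times> (space M - B))"
        using B by (auto intro!: rect_space)
      ultimately show ?case
        using Compl unfolding good_def by (simp only: simp_thms) (intro conjI souslin_Un souslin_Int; simp)
    next
      case (Union V)
      have "(\<Union>n. V n) \<times> B = (\<Union>n. V n \<times> B)"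
        by blast
      then show ?case
        using union[of "\<lambda>n. V n \<times> B"] Union by simp
    next
      case Empty
      show ?case
        using rect_space[of "space M"] rect_space[of "{}"] by (auto simp: good_def)
    qed
  qed
  have "E \<in> sigma_sets (UNIV \<times> space M) {V \<times> B |V B. V \<in> sets (borel :: 'g measure) \<and> B \<in> sets M}"
    using assms(2) by (simp add: sets_pair_measure)
  then have "good E"
  proof induction
    case (Compl S)
    then have "S \<subseteq> UNIV \<times> space M"
      using sets_pair_measure[of "borel :: 'g measure" M] sets.sets_into_space[of S "borel \<Otimes>\<^sub>M M"]
      by (simp add: space_pair_measure)
    then show ?case
      using Compl compl by blast
  next
    case Empty
    show ?case
      using good_rect[of "{}" "{}"] by simp
  qed (use good_rect union in auto)
  then show ?thesis
    by (simp add: good_def)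
qed

subsection \<open>Measurable projection\<close>

text \<open>Prefixes of length \<open>k\<close> are coded by sequences that vanish from
  \<open>k\<close> on. Their finiteness turns each stage of a bounded scheme into a finite union, so
  that measurability and closedness are inherited from the pieces.\<close>

lemma finite_bounded_prefixes:
  "finite {a :: nat \<Rightarrow> nat. \<forall>i. (i < k \<longrightarrow> a i \<le> m i) \<and> (\<not> i < k \<longrightarrow> a i = 0)}"
proof -
  have "{a. \<forall>i. (i < k \<longrightarrow> a i \<le> m i) \<and> (\<not> i < k \<longrightarrow> a i = 0)}
      \<subseteq> {a. \<forall>i. (i \<in> {..<k} \<longrightarrow> a i \<in> {..Max (m ` {..<k})}) \<and> (i \<notin> {..<k} \<longrightarrow> a i = 0)}"
    by (auto intro: order_trans[OF _ Max_ge])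
  then show ?thesis
    by (rule finite_subset) (intro finite_set_of_finite_funs; simp)
qed

text \<open>Tychonoff's theorem for the finite factors \<open>{..m i}\<close>.\<close>

lemma compact_bounded_sequences: "compact {a :: nat \<Rightarrow> nat. \<forall>i. a i \<le> m i}"
proof -
  have "compactin (product_topology (\<lambda>_. euclidean) UNIV) (PiE UNIV (\<lambda>i. {..m i}))"
    by (simp add: compactin_PiE finite_imp_compact)
  moreover have "PiE UNIV (\<lambda>i. {..m i}) = {a. \<forall>i. a i \<le> m i}"
    by auto
  ultimately show ?thesis
    by (simp add: euclidean_product_topology)
qed

text \<open>Choquet's capacitability argument: bounding the indices of the scheme one by one loses
  arbitrarily little outer measure, and by compactness the bounded part of the scheme has a
  projection that is the intersection of the measurable projections of its finite stages.\<close>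

lemma souslin_inner_approximation:
  fixes E :: "('g::t2_space \<times> 'x) set"
  assumes "finite_measure M" and E: "souslin M E" and K: "compact K" "E \<subseteq> K \<times> space M"
    and r: "r < outer_measure_of M (snd ` E)"
  shows "\<exists>B\<in>sets M. B \<subseteq> snd ` E \<and> r \<le> emeasure M B"
proof -
  interpret finite_measure M by fact
  obtain U A where sch: "souslin_scheme M U A" and E_eq: "E = (\<Union>a. \<Inter>k. U k a \<times> A k a)"
    using E unfolding souslin_def by blast
  have closed_U: "closed (U k a)" and A_sets: "A k a \<in> sets M" for k a
    using sch unfolding souslin_scheme_def by auto
  have dep: "U k a = U k b" "A k a = A k b" if "\<forall>i<k. a i = b i" for k a b
    using sch that unfolding souslin_scheme_def by blast+
  \<comment> \<open>\<open>P k m\<close> is the projection of the part of the scheme whose first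
    \<open>k\<close> indices are bounded by \<open>m\<close>. It need not be measurable, so its size
    is expressed by outer measure.\<close>
  define P where "P k m = {x. \<exists>a g. (\<forall>i<k. a i \<le> m i) \<and> g \<in> K \<and> (\<forall>j. g \<in> U j a \<and> x \<in> A j a)}"
    for k :: nat and m :: "nat \<Rightarrow> nat"
  have A_space: "x \<in> space M" if "x \<in> A j a" for x j a
    using A_sets[of j a] that sets.sets_into_space by blast
  have P_space: "P k m \<subseteq> space M" for k m
    unfolding P_def using A_space by blast
  have P_0: "P 0 m = snd ` E" for m
  proof
    show "P 0 m \<subseteq> snd ` E"
    proof
      fix x assume "x \<in> P 0 m"
      then obtain a g where "\<And>j. g \<in> U j a \<and> x \<in> A j a"
        unfolding P_def by blast
      then have "(g, x) \<in> E"
        unfolding E_eq by blast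
      then show "x \<in> snd ` E"
        by force
    qed
    show "snd ` E \<subseteq> P 0 m"
    proof
      fix x assume "x \<in> snd ` E"
      then obtain g where g: "(g, x) \<in> E"
        by auto
      then have "g \<in> K"
        using K by auto
      then show "x \<in> P 0 m"
        using g unfolding E_eq P_def by auto
    qed
  qed
  have P_Suc: "(\<Union>t. P (Suc k) (m(k := t))) = P k m" for k m
  proof
    show "(\<Union>t. P (Suc k) (m(k := t))) \<subseteq> P k m"
    proof
      fix x assume "x \<in> (\<Union>t. P (Suc k) (m(k := t)))"
      then obtain t a g where a: "\<forall>i<Suc k. a i \<le> (m(k := t)) i"
        and g: "g \<in> K \<and> (\<forall>j. g \<in> U j a \<and> x \<in> A j a)"
        unfolding P_def by blast
      have "\<forall>i<k. a i \<le> m i"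
        using a by (metis fun_upd_other less_SucI nat_neq_iff)
      with g show "x \<in> P k m"
        unfolding P_def by blast
    qed
    show "P k m \<subseteq> (\<Union>t. P (Suc k) (m(k := t)))"
    proof
      fix x assume "x \<in> P k m"
      then obtain a g where a: "\<forall>i<k. a i \<le> m i"
        and g: "g \<in> K \<and> (\<forall>j. g \<in> U j a \<and> x \<in> A j a)"
        unfolding P_def by blast
      have "\<forall>i<Suc k. a i \<le> (m(k := a k)) i"
        using a by (simp add: less_Suc_eq)
      with g have "x \<in> P (Suc k) (m(k := a k))"
        unfolding P_def by blast
      then show "x \<in> (\<Union>t. P (Suc k) (m(k := t)))"
        by blast
    qed
  qed
  have step: "\<exists>t. r < outer_measure_of M (P (Suc k) (m(k := t)))"
    if "r < outer_measure_of M (P k m)" for k m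
  proof -
    \<comment> \<open>As the bound \<open>t\<close> on index \<open>k\<close> grows, these sets
      exhaust \<open>P k m\<close>, and outer measure is continuous along increasing sequences of
      arbitrary sets.\<close>
    have "incseq (\<lambda>t. P (Suc k) (m(k := t)))"
    proof (intro monoI subsetI)
      fix s t :: nat and x assume "s \<le> t" "x \<in> P (Suc k) (m(k := s))"
      then obtain a g where a: "\<forall>i<Suc k. a i \<le> (m(k := s)) i"
        and g: "g \<in> K \<and> (\<forall>j. g \<in> U j a \<and> x \<in> A j a)"
        unfolding P_def by blast
      have "\<forall>i<Suc k. a i \<le> (m(k := t)) i"
        using a \<open>s \<le> t\<close> by (auto intro: order_trans)
      with g show "x \<in> P (Suc k) (m(k := t))"
        unfolding P_def by blast
    qed
    then have "(SUP t. outer_measure_of M (P (Suc k) (m(k := t)))) = outer_measure_of M (P k m)"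
      using SUP_outer_measure_of_incseq[of "\<lambda>t. P (Suc k) (m(k := t))" M] P_space P_Suc by simp
    with that show ?thesis
      by (metis less_SUP_iff)
  qed
  have "\<exists>f. \<forall>k. r < outer_measure_of M (P k (f k)) \<and> (\<exists>t. f (Suc k) = (f k)(k := t))"
  proof (rule dependent_nat_choice)
    show "\<exists>m. r < outer_measure_of M (P 0 m)"
      using r by (simp add: P_0)
    show "\<exists>m'. r < outer_measure_of M (P (Suc k) m') \<and> (\<exists>t. m' = m(k := t))"
      if "r < outer_measure_of M (P k m)" for m k
      using step[OF that] by blast
  qed
  then obtain f where f: "\<And>k. r < outer_measure_of M (P k (f k))"
    and f_Suc: "\<And>k. \<exists>t. f (Suc k) = (f k)(k := t)"
    by blast
  \<comment> \<open>The choice at stage \<open>Suc k\<close> alters entry \<open>k\<close> alone, so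
    entry \<open>i\<close> is final from \<open>f (Suc i)\<close> on.\<close>
  define m where "m i = f (Suc i) i" for i
  have f_m: "f k i = m i" if "i < k" for k i
    using that
  proof (induction k)
    case (Suc k)
    show ?case
    proof (cases "i = k")
      case False
      then show ?thesis
        using Suc f_Suc[of k] by auto
    qed (simp add: m_def)
  qed simp
  have P_m: "r < outer_measure_of M (P k m)" for k
  proof -
    have "P k (f k) = P k m"
      unfolding P_def using f_m by auto
    with f show ?thesis
      by metis
  qed
  \<comment> \<open>\<open>Q k\<close> keeps all the bounds but tests only the stages up to
    \<open>k\<close>. In contrast to \<open>P k m\<close>, only finitely many prefixes matter for
    it.\<close>
  define Q where "Q k = {x. \<exists>a g. (\<forall>i. a i \<le> m i) \<and> g \<in> K \<and> (\<forall>j\<le>k. g \<in> U j a \<and> x \<in> A j a)}"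
    for k
  have P_Q: "P k m \<subseteq> Q k" for k
  proof
    fix x assume "x \<in> P k m"
    then obtain a g where a: "\<forall>i<k. a i \<le> m i"
      and g: "g \<in> K \<and> (\<forall>j. g \<in> U j a \<and> x \<in> A j a)"
      unfolding P_def by blast
    \<comment> \<open>Stages up to \<open>k\<close> see only the first \<open>k\<close> entries, and
      the value 0 obeys every bound \<open>m i\<close>.\<close>
    define b where "b i = (if i < k then a i else 0)" for i
    have "U j b = U j a \<and> A j b = A j a" if "j \<le> k" for j
      using that dep[of j b a] unfolding b_def by auto
    moreover have "\<forall>i. b i \<le> m i"
      using a unfolding b_def by auto
    ultimately show "x \<in> Q k"
      using g unfolding Q_def by blast
  qed
  have Q_sets: "Q k \<in> sets M" for k
  proof -
    define D where "D = {a :: nat \<Rightarrow> nat. \<forall>i. (i < k \<longrightarrow> a i \<le> m i) \<and> (\<not> i < k \<longrightarrow> a i = 0)}"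
    have "finite D"
      unfolding D_def by (rule finite_bounded_prefixes)
    \<comment> \<open>The stages are rectangles: for a fixed prefix the condition on the group
      element decouples from \<open>x\<close> and merely decides whether the prefix enters the
      union.\<close>
    have "Q k = (\<Union>a\<in>{a\<in>D. K \<inter> (\<Inter>j\<in>{..k}. U j a) \<noteq> {}}. \<Inter>j\<in>{..k}. A j a)"
    proof (intro subset_antisym subsetI)
      fix x assume "x \<in> Q k"
      then obtain a g where a: "\<forall>i. a i \<le> m i"
        and g: "g \<in> K \<and> (\<forall>j\<le>k. g \<in> U j a \<and> x \<in> A j a)"
        unfolding Q_def by blast
      define b where "b i = (if i < k then a i else 0)" for i
      have "U j b = U j a \<and> A j b = A j a" if "j \<le> k" for j
        using that dep[of j b a] unfolding b_def by auto
      moreover have "b \<in> D"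
        using a unfolding b_def D_def by auto
      ultimately show "x \<in> (\<Union>a\<in>{a\<in>D. K \<inter> (\<Inter>j\<in>{..k}. U j a) \<noteq> {}}. \<Inter>j\<in>{..k}. A j a)"
        using g by blast
    next
      fix x assume "x \<in> (\<Union>a\<in>{a\<in>D. K \<inter> (\<Inter>j\<in>{..k}. U j a) \<noteq> {}}. \<Inter>j\<in>{..k}. A j a)"
      then obtain a g where a: "a \<in> D" and g: "g \<in> K \<and> (\<forall>j\<le>k. g \<in> U j a \<and> x \<in> A j a)"
        by blast
      have "\<forall>i. a i \<le> m i"
        using a unfolding D_def by (metis (mono_tags, lifting) mem_Collect_eq zero_le)
      with g show "x \<in> Q k"
        unfolding Q_def by blast
    qed
    also have "\<dots> \<in> sets M"
      using \<open>finite D\<close> A_sets by (intro sets.finite_UN sets.finite_INT) auto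
    finally show ?thesis .
  qed
  have Q_measure: "r \<le> emeasure M (Q k)" for k
    using P_m[of k] outer_measure_of_mono[OF P_Q[of k], of M] Q_sets[of k] by simp
  have "decseq Q"
    unfolding decseq_def
  proof (intro allI impI subsetI)
    fix k l x assume "k \<le> l" "x \<in> Q l"
    then obtain a g where a: "\<forall>i. a i \<le> m i" "g \<in> K" "\<forall>j\<le>l. g \<in> U j a \<and> x \<in> A j a"
      unfolding Q_def by blast
    then have "\<forall>j\<le>k. g \<in> U j a \<and> x \<in> A j a"
      using \<open>k \<le> l\<close> by auto
    with a(1,2) show "x \<in> Q k"
      unfolding Q_def by blast
  qed
  then have "emeasure M (\<Inter>k. Q k) = (INF k. emeasure M (Q k))"
    using Q_sets by (intro INF_emeasure_decseq[symmetric]) auto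
  then have "r \<le> emeasure M (\<Inter>k. Q k)"
    using Q_measure by (simp add: INF_greatest)
  moreover have "(\<Inter>k. Q k) \<in> sets M"
    using Q_sets by auto
  moreover have "(\<Inter>k. Q k) \<subseteq> snd ` E"
  proof
    fix x assume x: "x \<in> (\<Inter>k. Q k)"
    \<comment> \<open>For fixed \<open>x\<close>, a sequence and a group element that pass all
      stages together form a point of the compact set \<open>S\<close> common to the closed sets
      \<open>V j\<close>. Membership of \<open>x\<close> in every \<open>Q k\<close> supplies the
      finite intersection property.\<close>
    define S where "S = {a. \<forall>i. a i \<le> m i} \<times> K"
    define D where "D j = {a :: nat \<Rightarrow> nat. \<forall>i. (i < j \<longrightarrow> a i \<le> m i) \<and> (\<not> i < j \<longrightarrow> a i = 0)}" for j
    define V where "V j = (\<Union>b\<in>{b\<in>D j. x \<in> A j b}. {a. \<forall>i<j. a i = b i} \<times> U j b)" for j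
    have V_iff: "(a, g) \<in> V j \<longleftrightarrow> g \<in> U j a \<and> x \<in> A j a" if "\<forall>i. a i \<le> m i" for a g j
    proof
      assume "(a, g) \<in> V j"
      then obtain b where "\<forall>i<j. a i = b i" "x \<in> A j b" "g \<in> U j b"
        unfolding V_def by blast
      then show "g \<in> U j a \<and> x \<in> A j a"
        using dep[of j a b] by simp
    next
      assume g: "g \<in> U j a \<and> x \<in> A j a"
      define b where "b i = (if i < j then a i else 0)" for i
      have "\<forall>i<j. a i = b i" "b \<in> D j"
        using that unfolding b_def D_def by auto
      moreover have "U j a = U j b" "A j a = A j b"
        using dep[of j a b] unfolding b_def by auto
      ultimately show "(a, g) \<in> V j"
        using g unfolding V_def by blast
    qed
    have "S \<inter> (\<Inter>j\<in>UNIV. V j) \<noteq> {}"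
    proof (rule compact_imp_fip_image)
      show "compact S"
        unfolding S_def by (intro compact_Times compact_bounded_sequences K(1))
      show "closed (V j)" for j
      proof -
        have "finite {b\<in>D j. x \<in> A j b}"
          unfolding D_def using finite_bounded_prefixes[of j m] by (rule rev_finite_subset) auto
        moreover have "closed {a :: nat \<Rightarrow> nat. \<forall>i<j. a i = b i}" for b
        proof -
          have "{a :: nat \<Rightarrow> nat. \<forall>i<j. a i = b i} = (\<Inter>i\<in>{..<j}. {a. a i = b i})"
            by auto
          also have "closed \<dots>"
            by (intro closed_INT ballI closed_Collect_eq continuous_on_product_coordinates
                continuous_on_const)
          finally show ?thesis .
        qed
        ultimately show ?thesis
          unfolding V_def by (intro closed_UN ballI closed_Times closed_U)
      qed
      fix I :: "nat set" assume "finite I"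
      then obtain k where k: "I \<subseteq> {..k}"
        using finite_nat_iff_bounded_le by auto
      obtain a g where ag: "\<forall>i. a i \<le> m i" "g \<in> K" "\<forall>j\<le>k. g \<in> U j a \<and> x \<in> A j a"
        using x unfolding Q_def by blast
      then have "(a, g) \<in> S \<inter> (\<Inter>j\<in>I. V j)"
        using k V_iff[OF ag(1)] unfolding S_def by auto
      then show "S \<inter> (\<Inter>j\<in>I. V j) \<noteq> {}"
        by blast
    qed
    then obtain a g where "\<forall>i. a i \<le> m i" "\<And>j. (a, g) \<in> V j"
      unfolding S_def by auto
    then have "(g, x) \<in> E"
      using V_iff unfolding E_eq by blast
    then show "x \<in> snd ` E"
      by force
  qed
  ultimately show ?thesis
    by blast
qed

text \<open>A measurable hull of \<open>S\<close> and a countable union of inner approximations have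
  the same finite measure, so \<open>S\<close> lies between measurable sets that differ by a null
  set.\<close>

lemma sets_completion_inner_approximation:
  assumes "finite_measure M" "S \<subseteq> space M"
    and "\<And>r. r < outer_measure_of M S \<Longrightarrow> \<exists>B\<in>sets M. B \<subseteq> S \<and> r \<le> emeasure M B"
  shows "S \<in> sets (completion M)"
proof -
  interpret finite_measure M by fact
  obtain C where C: "C \<in> sets M" "S \<subseteq> C" "outer_measure_of M S = emeasure M C"
    using outer_measure_of_attain[OF assms(2)] by blast
  have "\<exists>B\<in>sets M. B \<subseteq> S \<and> emeasure M B = outer_measure_of M S"
  \<comment> \<open>With outer measure 0 there is no smaller \<open>r\<close> to start from, and the
    empty set serves instead.\<close>
  proof (cases "outer_measure_of M S = 0")
    case True
    then show ?thesis by (intro bexI[of _ "{}"]) auto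
  next
    case False
    then obtain u where u: "\<And>n::nat. u n < outer_measure_of M S" "u \<longlonglongrightarrow> outer_measure_of M S"
      using approx_from_below_dense_linorder[of 0 "outer_measure_of M S"] by (auto simp: zero_less_iff_neq_zero)
    have "\<forall>n. \<exists>B. B \<in> sets M \<and> B \<subseteq> S \<and> u n \<le> emeasure M B"
      using assms(3)[OF u(1)] by blast
    then obtain B where B: "\<And>n. B n \<in> sets M" "\<And>n. B n \<subseteq> S" "\<And>n. u n \<le> emeasure M (B n)"
      by metis
    have "u n \<le> emeasure M (\<Union>n. B n)" for n
      using B by (intro order_trans[OF B(3)] emeasure_mono) auto
    then have "outer_measure_of M S \<le> emeasure M (\<Union>n. B n)"
      using u(2) by (intro LIMSEQ_le_const2[OF u(2)]) auto
    moreover have "(\<Union>n. B n) \<subseteq> C"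
      using B(2) C(2) by blast
    then have "emeasure M (\<Union>n. B n) \<le> emeasure M C"
      using C(1) by (rule emeasure_mono)
    ultimately show ?thesis
      using B C by (intro bexI[of _ "\<Union>n. B n"]) auto
  qed
  then obtain B where B: "B \<in> sets M" "B \<subseteq> S" "emeasure M B = emeasure M C"
    using C by auto
  have "emeasure M (C - B) = 0"
    using B C by (subst emeasure_Diff) auto
  then have "C - B \<in> null_sets M"
    using B C by auto
  moreover have "S = B \<union> (S - B)" "S - B \<subseteq> C - B"
    using B C by auto
  ultimately show ?thesis
    using sets_completionI[of S B "S - B" "C - B" M] B by blast
qed

lemma measurable_projection:
  fixes E :: "('g::t2_space \<times> 'x) set"
  assumes "\<And>W :: 'g set. open W \<Longrightarrow> \<exists>C. (\<forall>n::nat. closed (C n)) \<and> W = (\<Union>n. C n)"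
    and "finite_measure M" "E \<in> sets ((borel :: 'g measure) \<Otimes>\<^sub>M M)"
    and "compact K" "E \<subseteq> K \<times> space M"
  shows "snd ` E \<in> sets (completion M)"
proof (rule sets_completion_inner_approximation)
  show "snd ` E \<subseteq> space M"
    using assms(5) by auto
  show "\<exists>B\<in>sets M. B \<subseteq> snd ` E \<and> r \<le> emeasure M B" if "r < outer_measure_of M (snd ` E)" for r
    using souslin_inner_approximation[OF assms(2) souslin_measurable[OF assms(1,3)] assms(4,5) that] .
qed fact

subsection \<open>Locally compact groups\<close>

lemma compact_neighbourhood:
  fixes W :: "'g::topological_space set"
  assumes "locally compact (UNIV :: 'g set)" "open W" "x \<in> W"
  obtains U K where "open U" "compact K" "x \<in> U" "U \<subseteq> K" "K \<subseteq> W"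
  using locallyE[OF assms(1), of W x] assms(2,3) by auto

text \<open>Lindelof's theorem, in a form that serves both for exhausting open sets by compact ones
  and for the covers in \<open>small_compact_cover\<close>.\<close>

lemma countable_cover:
  fixes W :: "'g::second_countable_topology set"
  assumes nbhd: "\<And>x. x \<in> W \<Longrightarrow> \<exists>U K. open U \<and> x \<in> U \<and> U \<subseteq> K \<and> P K \<and> K \<subseteq> W"
    and "P {}"
  shows "\<exists>C. (\<forall>n::nat. P (C n)) \<and> W = (\<Union>n. C n)"
proof -
  define \<U> where "\<U> = {U. open U \<and> (\<exists>K. U \<subseteq> K \<and> P K \<and> K \<subseteq> W)}"
  obtain \<V> where \<V>: "\<V> \<subseteq> \<U>" "countable \<V>" "\<Union>\<V> = \<Union>\<U>"
    using Lindelof[of \<U>] unfolding \<U>_def by blast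
  have "\<Union>\<U> = W"
  proof
    show "\<Union>\<U> \<subseteq> W"
      unfolding \<U>_def by auto
    show "W \<subseteq> \<Union>\<U>"
    proof
      fix x assume "x \<in> W"
      then obtain U K where "open U" "x \<in> U" "U \<subseteq> K" "P K" "K \<subseteq> W"
        using nbhd by metis
      then have "U \<in> \<U>"
        unfolding \<U>_def by auto
      with \<open>x \<in> U\<close> show "x \<in> \<Union>\<U>" by blast
    qed
  qed
  then have "\<Union>\<V> = W"
    using \<V>(3) by simp
  have "\<forall>U\<in>\<V>. \<exists>K. U \<subseteq> K \<and> P K \<and> K \<subseteq> W"
    using \<V>(1) unfolding \<U>_def by blast
  then obtain k where k: "\<And>U. U \<in> \<V> \<Longrightarrow> U \<subseteq> k U \<and> P (k U) \<and> k U \<subseteq> W"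
    by metis
  \<comment> \<open>The empty set makes the family nonempty, so that it can be enumerated by
    \<open>nat\<close> even when \<open>W\<close> is empty.\<close>
  define \<K> where "\<K> = insert {} (k ` \<V>)"
  have "countable \<K>" "\<K> \<noteq> {}"
    unfolding \<K>_def using \<V>(2) by auto
  then obtain C :: "nat \<Rightarrow> 'g set" where C: "\<K> = range C"
    by (metis uncountable_def)
  have "P K" if "K \<in> \<K>" for K
    using that k assms(2) unfolding \<K>_def by blast
  moreover have "\<Union>\<K> = W"
  proof
    show "\<Union>\<K> \<subseteq> W"
      using k unfolding \<K>_def by blast
    show "W \<subseteq> \<Union>\<K>"
      using k unfolding \<open>\<Union>\<V> = W\<close>[symmetric] \<K>_def by blast
  qed
  ultimately show ?thesis
    unfolding C by (intro exI[of _ C]) auto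
qed

lemma open_eq_UN_compact:
  fixes W :: "'g::second_countable_topology set"
  assumes "locally compact (UNIV :: 'g set)" "open W"
  shows "\<exists>C. (\<forall>n::nat. compact (C n)) \<and> W = (\<Union>n. C n)"
  by (rule countable_cover) (use compact_neighbourhood[OF assms] in \<open>metis\<close>, simp)

lemma measurable_projection_lc:
  fixes E :: "('g::{second_countable_topology, t2_space} \<times> 'x) set"
  assumes "locally compact (UNIV :: 'g set)"
    and "finite_measure M" "E \<in> sets ((borel :: 'g measure) \<Otimes>\<^sub>M M)"
    and "compact K" "E \<subseteq> K \<times> space M"
  shows "snd ` E \<in> sets (completion M)"
proof (rule measurable_projection[OF _ assms(2-5)])
  show "\<exists>C. (\<forall>n::nat. closed (C n)) \<and> W = (\<Union>n. C n)" if W: "open W" for W :: "'g set"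
  proof -
    obtain C where "\<forall>n::nat. compact (C n)" "W = (\<Union>n. C n)"
      using open_eq_UN_compact[OF assms(1) W] by (elim exE conjE)
    then show ?thesis
      by (intro exI[of _ C]) (simp add: compact_imp_closed)
  qed
qed

text \<open>A form of discreteness adapted to counting in compact sets; it passes to subsets and to
  sums with finite sets.\<close>

definition locally_finite :: "'g::topological_space set \<Rightarrow> bool" where
  "locally_finite D \<longleftrightarrow> (\<forall>K. compact K \<longrightarrow> finite (D \<inter> K))"

text \<open>Some neighbourhood of the identity contains no nonzero element of \<open>D\<close>, and
  by continuity of subtraction every point has a compact neighbourhood whose differences stay in it.
  A set whose differences lie in \<open>D\<close> has at most one element in each piece, which
  reduces counting visits to detecting them.\<close>

lemma small_compact_cover:
  fixes D :: "'g::{topological_group_add, second_countable_topology, t2_space} set"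
  assumes lc: "locally compact (UNIV :: 'g set)" and D: "locally_finite D"
  shows "\<exists>W. (\<forall>n::nat. compact (W n) \<and> (\<forall>a\<in>W n. \<forall>b\<in>W n. a - b \<in> D \<longrightarrow> a = b)) \<and>
           UNIV = (\<Union>n. W n)"
proof (rule countable_cover)
  fix x :: 'g
  obtain U0 K0 where 0: "open U0" "compact K0" "(0::'g) \<in> U0" "U0 \<subseteq> K0"
    using compact_neighbourhood[OF lc, of UNIV 0] by auto
  \<comment> \<open>Deleting the finitely many nonzero points of \<open>D\<close> in
    \<open>K0\<close> leaves an open neighbourhood of \<open>0\<close>.\<close>
  define V where "V = U0 - (D \<inter> K0 - {0})"
  have "finite (D \<inter> K0)"
    using D 0(2) unfolding locally_finite_def by blast
  then have "open V"
    unfolding V_def by (intro open_Diff 0(1) finite_imp_closed) auto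
  moreover have "continuous_on UNIV (\<lambda>p::'g \<times> 'g. fst p - snd p)"
    by (intro continuous_intros)
  ultimately have "open ((\<lambda>p::'g \<times> 'g. fst p - snd p) -` V)"
    by (simp add: continuous_on_open_vimage)
  moreover have "(x, x) \<in> (\<lambda>p::'g \<times> 'g. fst p - snd p) -` V"
    using 0 by (simp add: V_def)
  ultimately obtain S T where ST: "open S" "open T" "(x, x) \<in> S \<times> T"
      "S \<times> T \<subseteq> (\<lambda>p::'g \<times> 'g. fst p - snd p) -` V"
    by (rule open_prod_elim)
  have "x \<in> S \<inter> T"
    using ST(3) by auto
  then obtain U K where U: "open U" "compact K" "x \<in> U" "U \<subseteq> K" "K \<subseteq> S \<inter> T"
    by (rule compact_neighbourhood[OF lc open_Int[OF ST(1,2)]])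
  have "a = b" if "a \<in> K" "b \<in> K" "a - b \<in> D" for a b
  proof -
    have "a - b \<in> V"
      using subsetD[OF ST(4), of "(a, b)"] that U(5) by auto
    with that(3) 0(4) show ?thesis
      unfolding V_def by auto
  qed
  with U show "\<exists>U K. open U \<and> x \<in> U \<and> U \<subseteq> K \<and>
      (compact K \<and> (\<forall>a\<in>K. \<forall>b\<in>K. a - b \<in> D \<longrightarrow> a = b)) \<and> K \<subseteq> UNIV"
    by blast
qed simp

section \<open>Measures that are finite on compact sets\<close>

lemma sigma_finite_measure_lc:
  fixes m :: "'g::{second_countable_topology, t2_space} measure"
  assumes "locally compact (UNIV :: 'g set)" "sets m = sets borel"
    and "\<And>K. compact K \<Longrightarrow> emeasure m K < \<infinity>"
  shows "sigma_finite_measure m"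
proof -
  obtain C :: "nat \<Rightarrow> 'g set" where C: "\<forall>n. compact (C n)" "UNIV = (\<Union>n. C n)"
    using open_eq_UN_compact[OF assms(1) open_UNIV] by (elim exE conjE)
  show ?thesis
    unfolding sigma_finite_measure_def
    using C assms(2,3) sets_eq_imp_space_eq[OF assms(2)]
    by (intro exI[of _ "range C"]) (auto simp: borel_compact less_top)
qed

text \<open>Inversion turns the right-invariant \<open>m\<close> into a left Haar measure
  \<open>m'\<close>; unimodularity makes \<open>m'\<close> right-invariant as well, and inverting
  back makes \<open>m\<close> left-invariant.\<close>

lemma unimodular_imp_left_invariant:
  fixes m :: "'g::{topological_group_add, second_countable_topology, t2_space} measure"
  assumes uni: "unimodular (UNIV :: 'g set)" and sets_m: "sets m = sets borel"
    and fin: "\<And>K. compact K \<Longrightarrow> emeasure m K < \<infinity>"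
    and right: "\<And>B g. B \<in> sets borel \<Longrightarrow> emeasure m ((\<lambda>a. a + g) ` B) = emeasure m B"
    and B: "B \<in> sets borel"
  shows "emeasure m ((\<lambda>a. g + a) ` B) = emeasure m B"
proof -
  have space_m: "space m = UNIV"
    using sets_eq_imp_space_eq[OF sets_m] by simp
  have minus_meas: "(uminus :: 'g \<Rightarrow> 'g) \<in> borel_measurable m"
    unfolding measurable_cong_sets[OF sets_m refl]
    by (intro borel_measurable_continuous_onI continuous_intros)
  have minus_image: "uminus ` X = uminus -` X" for X :: "'g set"
    by (auto simp: image_iff) (metis minus_minus)
  define m' where "m' = distr m borel uminus"
  have m': "emeasure m' X = emeasure m (uminus ` X)" if "X \<in> sets borel" for X
    using that minus_meas by (simp add: m'_def emeasure_distr space_m minus_image)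
  have minus_sets: "uminus ` X \<in> sets borel" if "X \<in> sets borel" for X :: "'g set"
    using measurable_sets[OF minus_meas that] sets_m by (simp add: minus_image space_m)
  have add_sets: "(\<lambda>a. g + a) ` X \<in> sets borel" if "X \<in> sets borel" for X and g :: 'g
  proof -
    have "(\<lambda>a. g + a) ` X = (\<lambda>a. - g + a) -` X"
      by (auto simp: image_iff add.assoc[symmetric]) (metis add.assoc add.right_inverse add_0)
    moreover have "(\<lambda>a. - g + a) \<in> borel_measurable borel"
      by (intro borel_measurable_continuous_onI continuous_intros)
    ultimately show ?thesis
      using measurable_sets[of "\<lambda>a. - g + a" borel borel X] that by simp
  qed
  show ?thesis
  \<comment> \<open>Haar measures are nonzero by definition, so the zero measure is treated
    separately.\<close>
  proof (cases "emeasure m UNIV = 0")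
    case True
    then have "emeasure m X = 0" if "X \<in> sets borel" for X
      using emeasure_mono[of X UNIV m] that sets_m by simp
    then show ?thesis
      using B add_sets by simp
  next
    case False
    have "left_haar_measure UNIV m'"
      unfolding left_haar_measure_def
    proof (intro conjI allI impI ballI)
      show "sets m' = sets (restrict_space borel UNIV)"
        by (simp add: m'_def sets_restrict_space)
      have "uminus ` UNIV = (UNIV :: 'g set)"
        by (auto simp: minus_image)
      then show "emeasure m' UNIV \<noteq> 0"
        using False m'[of UNIV] by simp
      show "emeasure m' K < \<infinity>" if "K \<subseteq> UNIV \<and> compact K" for K
        using that m'[of K] fin[of "uminus ` K"]
        by (simp add: borel_compact compact_continuous_image continuous_intros)
      fix s :: 'g and X assume "X \<in> sets m'"
      then have X: "X \<in> sets borel"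
        by (simp add: m'_def)
      have "uminus ` (\<lambda>a. s + a) ` X = (\<lambda>a. a + - s) ` uminus ` X"
        by (simp add: image_image minus_add)
      then show "emeasure m' ((\<lambda>a. s + a) ` X) = emeasure m' X"
        using X add_sets[of X s] right[of "uminus ` X" "- s"] minus_sets by (simp add: m')
    qed
    then have *: "emeasure m' ((\<lambda>a. a + s) ` X) = emeasure m' X" if "X \<in> sets borel" for s X
      using uni that unfolding unimodular_def by (simp add: m'_def)
    have img: "(\<lambda>a. a + - g) ` uminus ` B = uminus ` (\<lambda>a. g + a) ` B"
      by (simp add: image_image minus_add)
    have "emeasure m ((\<lambda>a. g + a) ` B) = emeasure m' ((\<lambda>a. a + - g) ` uminus ` B)"
      unfolding img using m'[OF minus_sets[OF add_sets[OF B]]] by (simp add: image_image)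
    also have "\<dots> = emeasure m' (uminus ` B)"
      by (rule *[OF minus_sets[OF B]])
    also have "\<dots> = emeasure m B"
      using m'[OF minus_sets[OF B]] by (simp add: image_image)
    finally show ?thesis .
  qed
qed

subsection \<open>The intensity measure of the visits to a set\<close>

text \<open>In the application \<open>A\<close> is the saturation of the cross section by \<Gamma>,
  and \<open>D\<close> is the threefold sum of \<Lambda>. The approximate lattice enters here only
  through the bound \<open>visits_diff\<close> on differences of visits.\<close>

locale locally_finite_visits = prob_space M
  for M :: "'x measure" +
  fixes act :: "'g::{topological_group_add, second_countable_topology, t2_space} \<Rightarrow> 'x \<Rightarrow> 'x"
    and A :: "'x set" and D :: "'g set"
  assumes lc: "locally compact (UNIV :: 'g set)"
    and action: "borel_action act M"
    and invariant: "\<And>g. distr M M (act g) = M"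
    and A_sets: "A \<in> sets M"
    and D: "locally_finite D"
    and visits_diff: "\<And>x g h. x \<in> space M \<Longrightarrow> act g x \<in> A \<Longrightarrow> act h x \<in> A \<Longrightarrow> g - h \<in> D"
begin

definition visits :: "'x \<Rightarrow> 'g set" where
  "visits x = {g. act g x \<in> A}"

text \<open>The counting measure gives infinite sets the value infinity and makes the count
  countably additive in \<open>B\<close>.\<close>

definition visit_count :: "'g set \<Rightarrow> 'x \<Rightarrow> ennreal" where
  "visit_count B x = emeasure (count_space UNIV) (visits x \<inter> B)"

definition visit_sum :: "('g \<Rightarrow> ennreal) \<Rightarrow> 'x \<Rightarrow> ennreal" where
  "visit_sum \<phi> x = (\<integral>\<^sup>+g. \<phi> g * indicator (visits x) g \<partial>count_space UNIV)"

text \<open>The integral is taken over the completion because measurable projection yields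
  measurability of the counts only up to null sets.\<close>

definition intensity :: "'g measure" where
  "intensity = measure_of UNIV (sets borel) (\<lambda>B. \<integral>\<^sup>+x. visit_count B x \<partial>completion M)"

lemma act_measurable_pair: "(\<lambda>(g, x). act g x) \<in> borel \<Otimes>\<^sub>M M \<rightarrow>\<^sub>M M"
  using action unfolding borel_action_def by blast

lemma act_measurable: "act g \<in> M \<rightarrow>\<^sub>M M"
  using measurable_compose[OF measurable_Pair1'[of g borel M] act_measurable_pair] by simp

lemma act_add: "x \<in> space M \<Longrightarrow> act (g + h) x = act g (act h x)"
  using action unfolding borel_action_def by blast

text \<open>This is the projection of the measurable set of pairs \<open>(g, x)\<close> with
  \<open>g \<in> B\<close> and \<open>act g x \<in> A\<close>, whose group coordinates stay in the
  compact set \<open>K\<close>.\<close>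

lemma hit_sets:
  assumes "B \<in> sets borel" "compact K" "B \<subseteq> K"
  shows "{x \<in> space M. visits x \<inter> B \<noteq> {}} \<in> sets (completion M)"
proof -
  define E where "E = (B \<times> space M) \<inter> ((\<lambda>(g, x). act g x) -` A \<inter> space (borel \<Otimes>\<^sub>M M))"
  have "E \<in> sets (borel \<Otimes>\<^sub>M M)"
    unfolding E_def
    by (intro sets.Int pair_measureI assms(1) sets.top measurable_sets[OF act_measurable_pair A_sets])
  moreover have "E \<subseteq> K \<times> space M"
    unfolding E_def using assms(3) by auto
  ultimately have "snd ` E \<in> sets (completion M)"
    using measurable_projection_lc[OF lc finite_measure_axioms _ assms(2)] by blast
  moreover have "snd ` E = {x \<in> space M. visits x \<inter> B \<noteq> {}}"
  proof (intro subset_antisym subsetI)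
    fix x assume "x \<in> {x \<in> space M. visits x \<inter> B \<noteq> {}}"
    then obtain g where "(g, x) \<in> E"
      unfolding E_def visits_def by (auto simp: space_pair_measure)
    then show "x \<in> snd ` E"
      by force
  qed (auto simp: E_def visits_def)
  ultimately show ?thesis
    by simp
qed

text \<open>Subtracting one visit in \<open>K\<close> from all visits in \<open>K\<close> maps them
  injectively into \<open>D'\<close>, the finite set of those differences of points of
  \<open>K\<close> that lie in \<open>D\<close>. This set is the same for all \<open>x\<close>, so
  the bound is uniform.\<close>

lemma visits_card:
  assumes "compact K"
  shows "\<exists>c. \<forall>x\<in>space M. finite (visits x \<inter> K) \<and> card (visits x \<inter> K) \<le> c"
proof (intro exI ballI)
  fix x assume x: "x \<in> space M"
  define D' where "D' = D \<inter> (\<lambda>p. fst p - snd p) ` (K \<times> K)"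
  have "compact ((\<lambda>p::'g \<times> 'g. fst p - snd p) ` (K \<times> K))"
    by (intro compact_continuous_image compact_Times assms continuous_intros)
  then have fin: "finite D'"
    using D unfolding locally_finite_def D'_def by blast
  show "finite (visits x \<inter> K) \<and> card (visits x \<inter> K) \<le> card D'"
  proof (cases "visits x \<inter> K = {}")
    case False
    then obtain g0 where g0: "g0 \<in> visits x" "g0 \<in> K"
      by blast
    have inj: "inj_on (\<lambda>g. g - g0) (visits x \<inter> K)"
      by (auto intro: inj_onI)
    have "(\<lambda>g. g - g0) ` (visits x \<inter> K) \<subseteq> D'"
    proof
      fix d assume "d \<in> (\<lambda>g. g - g0) ` (visits x \<inter> K)"
      then obtain g where g: "g \<in> visits x" "g \<in> K" "d = fst (g, g0) - snd (g, g0)"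
        by auto
      then have "d \<in> (\<lambda>p. fst p - snd p) ` (K \<times> K)"
        using g0(2) by blast
      with visits_diff[OF x, of g g0] g g0 show "d \<in> D'"
        unfolding D'_def visits_def by simp
    qed
    with inj fin show ?thesis
      by (meson card_inj_on_le inj_on_finite)
  qed simp
qed

text \<open>\<open>B\<close> is cut into countably many Borel pieces that contain at most one visit
  each. On such a piece the count is the indicator of being hit, to which \<open>hit_sets\<close>
  applies.\<close>

lemma visit_count_measurable:
  assumes B: "B \<in> sets borel"
  shows "visit_count B \<in> borel_measurable (completion M)"
proof -
  obtain W :: "nat \<Rightarrow> 'g set" where
    W: "\<forall>n. compact (W n) \<and> (\<forall>a\<in>W n. \<forall>b\<in>W n. a - b \<in> D \<longrightarrow> a = b)" "UNIV = (\<Union>n. W n)"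
    using small_compact_cover[OF lc D] by (elim exE conjE)
  define V where "V n = B \<inter> disjointed W n" for n
  have V_sets: "V n \<in> sets borel" for n
  proof -
    have "W i \<in> sets borel" for i
      using W(1) by (intro borel_compact) simp
    then show ?thesis
      unfolding V_def disjointed_def by (intro sets.Int sets.Diff sets.finite_UN B finite_atLeastLessThan)
  qed
  have V_W: "V n \<subseteq> W n" for n
    unfolding V_def using disjointed_subset[of W n] by blast
  have disj: "disjoint_family (\<lambda>n. visits x \<inter> V n)" for x
    using disjoint_family_disjointed[of W] unfolding V_def disjoint_family_on_def by blast
  have cover: "(\<Union>n. visits x \<inter> V n) = visits x \<inter> B" for x
  proof -
    have "(\<Union>n. visits x \<inter> V n) = visits x \<inter> B \<inter> (\<Union>n. disjointed W n)"
      unfolding V_def by auto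
    then show ?thesis
      by (simp only: UN_disjointed_eq W(2)[symmetric] Int_UNIV_right)
  qed
  have single: "emeasure (count_space UNIV) (visits x \<inter> V n)
      = indicator {x \<in> space M. visits x \<inter> V n \<noteq> {}} x" if x: "x \<in> space M" for x n
  proof (cases "visits x \<inter> V n = {}")
    case False
    then obtain g where g: "g \<in> visits x \<inter> V n"
      by blast
    have "h = g" if "h \<in> visits x \<inter> V n" for h
      using visits_diff[OF x, of h g] W(1) V_W[of n] g that unfolding visits_def by blast
    with g have "visits x \<inter> V n = {g}"
      by blast
    with x show ?thesis
      by simp
  qed simp
  have "visit_count B x = (\<Sum>n. indicator {x \<in> space M. visits x \<inter> V n \<noteq> {}} x)"
    if "x \<in> space M" for x
  proof -
    have "visit_count B x = (\<Sum>n. emeasure (count_space UNIV) (visits x \<inter> V n))"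
      unfolding visit_count_def cover[of x, symmetric]
      using disj[of x] by (intro suminf_emeasure[symmetric]) auto
    with single[OF that] show ?thesis
      by simp
  qed
  moreover have "(\<lambda>x. \<Sum>n. indicator {x \<in> space M. visits x \<inter> V n \<noteq> {}} x :: ennreal)
      \<in> borel_measurable (completion M)"
    using hit_sets[OF V_sets _ V_W] W(1)
    by (intro borel_measurable_suminf_order borel_measurable_indicator) auto
  ultimately show ?thesis
    by (subst measurable_cong) auto
qed

section \<open>The intensity measure and the Campbell formula\<close>

lemma sets_intensity [simp]: "sets intensity = sets borel"
  unfolding intensity_def by (metis sets.sets_measure_of_eq sets.top space_borel sets_measure_of_conv)

lemma space_intensity [simp]: "space intensity = UNIV"
  using sets_eq_imp_space_eq[OF sets_intensity] by simp

lemma emeasure_intensity: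
  assumes "B \<in> sets borel"
  shows "emeasure intensity B = (\<integral>\<^sup>+x. visit_count B x \<partial>completion M)"
proof (rule emeasure_measure_of[OF intensity_def])
  show "positive (sets intensity) (\<lambda>B. \<integral>\<^sup>+x. visit_count B x \<partial>completion M)"
    by (simp add: positive_def visit_count_def)
  show "countably_additive (sets intensity) (\<lambda>B. \<integral>\<^sup>+x. visit_count B x \<partial>completion M)"
  proof (rule countably_additiveI)
    fix F :: "nat \<Rightarrow> 'g set"
    assume F: "range F \<subseteq> sets intensity" "disjoint_family F"
    have "visit_count (\<Union>i. F i) x = (\<Sum>i. visit_count (F i) x)" for x
    proof -
      have "disjoint_family (\<lambda>i. visits x \<inter> F i)"
        using F(2) unfolding disjoint_family_on_def by blast
      then have "(\<Sum>i. visit_count (F i) x) = emeasure (count_space UNIV) (\<Union>i. visits x \<inter> F i)"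
        unfolding visit_count_def by (intro suminf_emeasure) auto
      then show ?thesis
        unfolding visit_count_def by simp
    qed
    moreover have "(\<integral>\<^sup>+x. (\<Sum>i. visit_count (F i) x) \<partial>completion M)
        = (\<Sum>i. \<integral>\<^sup>+x. visit_count (F i) x \<partial>completion M)"
      using F(1) by (intro nn_integral_suminf visit_count_measurable) auto
    ultimately show "(\<Sum>i. \<integral>\<^sup>+x. visit_count (F i) x \<partial>completion M)
        = (\<integral>\<^sup>+x. visit_count (\<Union>i. F i) x \<partial>completion M)"
      by simp
  qed
qed (use assms in auto)

lemma visit_sum_indicator: "visit_sum (indicator B) x = visit_count B x"
proof -
  have "visit_sum (indicator B) x = (\<integral>\<^sup>+g. indicator (visits x \<inter> B) g \<partial>count_space UNIV)"
    unfolding visit_sum_def by (intro nn_integral_cong) (auto split: split_indicator)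
  then show ?thesis
    by (simp add: visit_count_def)
qed

text \<open>For indicator functions the formula is the definition of the intensity; multiples, sums
  and monotone limits carry it to all nonnegative Borel functions.\<close>

lemma Campbell_formula:
  assumes "\<phi> \<in> borel_measurable borel"
  shows "visit_sum \<phi> \<in> borel_measurable (completion M)"
    and "(\<integral>\<^sup>+x. visit_sum \<phi> x \<partial>completion M) = (\<integral>\<^sup>+g. \<phi> g \<partial>intensity)"
proof -
  have "visit_sum \<phi> \<in> borel_measurable (completion M) \<and>
      (\<integral>\<^sup>+x. visit_sum \<phi> x \<partial>completion M) = (\<integral>\<^sup>+g. \<phi> g \<partial>intensity)"
    using assms
  proof (induction rule: borel_measurable_induct)
    case (cong f g)
    then have "f = g"
      by auto
    with cong show ?case
      by simp
  next
    case (set B)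
    then show ?case
      using visit_count_measurable[of B] emeasure_intensity[of B]
      by (simp add: visit_sum_indicator[abs_def])
  next
    case (mult u c)
    have "visit_sum (\<lambda>g. c * u g) = (\<lambda>x. c * visit_sum u x)"
      unfolding visit_sum_def by (auto simp: mult.assoc nn_integral_cmult)
    moreover have "u \<in> borel_measurable intensity"
      using mult by (simp cong: measurable_cong_sets)
    moreover have [measurable]: "visit_sum u \<in> borel_measurable (completion M)"
      using mult by blast
    then have "(\<lambda>x. c * visit_sum u x) \<in> borel_measurable (completion M)"
      by measurable
    ultimately show ?case
      using mult by (simp add: nn_integral_cmult)
  next
    case (add u v)
    have "visit_sum (\<lambda>g. v g + u g) = (\<lambda>x. visit_sum v x + visit_sum u x)"
      unfolding visit_sum_def by (auto simp: distrib_right nn_integral_add)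
    moreover have "u \<in> borel_measurable intensity" "v \<in> borel_measurable intensity"
      using add by (simp_all cong: measurable_cong_sets)
    moreover have [measurable]: "visit_sum u \<in> borel_measurable (completion M)"
        "visit_sum v \<in> borel_measurable (completion M)"
      using add by blast+
    then have "(\<lambda>x. visit_sum v x + visit_sum u x) \<in> borel_measurable (completion M)"
      by measurable
    ultimately show ?case
      using add by (simp add: nn_integral_add)
  next
    case (seq U)
    have sup: "visit_sum (SUP i. U i) = (\<lambda>x. SUP i. visit_sum (U i) x)"
    proof
      fix x
      have "visit_sum (SUP i. U i) x = (\<integral>\<^sup>+g. (SUP i. U i g * indicator (visits x) g) \<partial>count_space UNIV)"
        unfolding visit_sum_def by (simp add: SUP_mult_right_ennreal image_comp)
      also have "\<dots> = (SUP i. visit_sum (U i) x)"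
        unfolding visit_sum_def using seq(3)
        by (intro nn_integral_monotone_convergence_SUP) (auto simp: incseq_def le_fun_def intro!: mult_right_mono)
      finally show "visit_sum (SUP i. U i) x = (SUP i. visit_sum (U i) x)" .
    qed
    have meas [measurable]: "visit_sum (U i) \<in> borel_measurable (completion M)"
      and int: "(\<integral>\<^sup>+x. visit_sum (U i) x \<partial>completion M) = (\<integral>\<^sup>+g. U i g \<partial>intensity)" for i
      using seq by blast+
    have "incseq (\<lambda>i. visit_sum (U i))"
      using seq(3) unfolding visit_sum_def
      by (auto simp: incseq_def le_fun_def intro!: nn_integral_mono mult_right_mono)
    then have "(\<integral>\<^sup>+x. (SUP i. visit_sum (U i) x) \<partial>completion M) = (SUP i. \<integral>\<^sup>+g. U i g \<partial>intensity)"
      unfolding int[symmetric] by (rule nn_integral_monotone_convergence_SUP[OF _ meas])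
    also have "\<dots> = (\<integral>\<^sup>+g. (SUP i. U i g) \<partial>intensity)"
      using seq(1,3) by (intro nn_integral_monotone_convergence_SUP[symmetric]) (auto cong: measurable_cong_sets)
    finally have "(\<integral>\<^sup>+x. visit_sum (SUP i. U i) x \<partial>completion M) = (\<integral>\<^sup>+g. (SUP i. U i) g \<partial>intensity)"
      unfolding sup by (simp add: image_comp)
    moreover have "visit_sum (SUP i. U i) \<in> borel_measurable (completion M)"
      unfolding sup by measurable
    ultimately show ?case
      by (intro conjI)
  qed
  then show "visit_sum \<phi> \<in> borel_measurable (completion M)"
    and "(\<integral>\<^sup>+x. visit_sum \<phi> x \<partial>completion M) = (\<integral>\<^sup>+g. \<phi> g \<partial>intensity)"
    by auto
qed

section \<open>Finiteness on compact sets and invariance of the intensity\<close>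

lemma intensity_compact:
  assumes "compact K"
  shows "emeasure intensity K < \<infinity>"
proof -
  obtain c where c: "\<And>x. x \<in> space M \<Longrightarrow> finite (visits x \<inter> K) \<and> card (visits x \<inter> K) \<le> c"
    using visits_card[OF assms] by blast
  have "emeasure intensity K = (\<integral>\<^sup>+x. visit_count K x \<partial>completion M)"
    by (rule emeasure_intensity) (simp add: borel_compact assms)
  also have "\<dots> \<le> (\<integral>\<^sup>+x. of_nat c \<partial>completion M)"
    using c by (intro nn_integral_mono) (simp add: visit_count_def)
  also have "\<dots> = of_nat c"
    by (simp add: nn_integral_completion emeasure_space_1)
  finally show ?thesis
    by (simp add: of_nat_less_top order.strict_trans1)
qed

text \<open>A function measurable for the completion agrees almost everywhere with an
  \<open>M\<close>-measurable one, and invariance of \<open>M\<close> lets the exceptional null set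
  be pulled back along \<open>act g\<close>.\<close>

lemma nn_integral_act:
  fixes f :: "'x \<Rightarrow> ennreal"
  assumes "f \<in> borel_measurable (completion M)"
  shows "(\<integral>\<^sup>+x. f (act g x) \<partial>completion M) = (\<integral>\<^sup>+x. f x \<partial>completion M)"
proof -
  obtain f' where f': "f' \<in> borel_measurable M" "AE x in M. f x = f' x"
    using completion_ex_borel_measurable[OF assms] by blast
  have "AE x in distr M M (act g). f x = f' x"
    unfolding invariant by (rule f'(2))
  then have "AE x in M. f (act g x) = f' (act g x)"
    by (rule AE_distrD[OF act_measurable])
  then have "(\<integral>\<^sup>+x. f (act g x) \<partial>M) = (\<integral>\<^sup>+x. f' (act g x) \<partial>M)"
    by (rule nn_integral_cong_AE)
  also have "\<dots> = (\<integral>\<^sup>+x. f' x \<partial>distr M M (act g))"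
    using f'(1) by (simp add: nn_integral_distr act_measurable)
  also have "\<dots> = (\<integral>\<^sup>+x. f x \<partial>M)"
    unfolding invariant using f'(2) by (intro nn_integral_cong_AE) auto
  finally show ?thesis
    by (simp add: nn_integral_completion)
qed

text \<open>\<open>h\<close> is a visit of \<open>act g x\<close> exactly if \<open>h + g\<close> is
  a visit of \<open>x\<close>. Translating \<open>B\<close> on the right thus amounts to moving the
  base point, which does not change the integral.\<close>

lemma intensity_right_invariant:
  assumes B: "B \<in> sets borel"
  shows "emeasure intensity ((\<lambda>a. a + g) ` B) = emeasure intensity B"
proof -
  have image_eq: "(\<lambda>a. a + g) ` B = (\<lambda>a. a - g) -` B"
    by (auto simp: image_iff) (metis diff_add_cancel)
  have "(\<lambda>a. a - g) \<in> borel_measurable borel"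
    by (intro borel_measurable_continuous_onI continuous_intros)
  then have Bg: "(\<lambda>a. a + g) ` B \<in> sets borel"
    using measurable_sets[of "\<lambda>a. a - g" borel borel B] B image_eq by simp
  have "visit_count ((\<lambda>a. a + g) ` B) x = visit_count B (act g x)" if "x \<in> space M" for x
  proof -
    have "visits x \<inter> (\<lambda>a. a + g) ` B = (\<lambda>a. a + g) ` (visits (act g x) \<inter> B)"
      unfolding visits_def using act_add[OF that] by auto
    moreover have "inj_on (\<lambda>a. a + g) S" for S
      by (auto intro: inj_onI)
    ultimately show ?thesis
      unfolding visit_count_def by (simp add: emeasure_count_space card_image finite_image_iff)
  qed
  then have "emeasure intensity ((\<lambda>a. a + g) ` B) = (\<integral>\<^sup>+x. visit_count B (act g x) \<partial>completion M)"
    unfolding emeasure_intensity[OF Bg] by (intro nn_integral_cong) simp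
  also have "\<dots> = emeasure intensity B"
    unfolding emeasure_intensity[OF B] by (intro nn_integral_act visit_count_measurable B)
  finally show ?thesis .
qed

lemma sigma_finite_intensity: "sigma_finite_measure intensity"
  using lc intensity_compact by (intro sigma_finite_measure_lc) auto

text \<open>In the application \<open>\<nu>\<close> is Haar measure of the subgroup restricted to a
  set of finite measure. The Campbell formula and Fubini's theorem reduce the integral to the
  intensities of the left translates \<open>f + K\<close>, which equal that of \<open>K\<close>
  because the group is unimodular.\<close>

lemma nn_integral_visit_sum_translates:
  fixes \<nu> :: "'g measure"
  assumes uni: "unimodular (UNIV :: 'g set)"
    and \<nu>: "finite_measure \<nu>" "sets \<nu> = sets borel"
    and K: "K \<in> sets borel"
  shows "visit_sum (\<lambda>g. emeasure \<nu> {f. - f + g \<in> K}) \<in> borel_measurable (completion M)"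
    and "(\<integral>\<^sup>+x. visit_sum (\<lambda>g. emeasure \<nu> {f. - f + g \<in> K}) x \<partial>completion M)
      = emeasure \<nu> UNIV * emeasure intensity K"
proof -
  interpret \<nu>: finite_measure \<nu> by fact
  interpret \<eta>: sigma_finite_measure intensity by (rule sigma_finite_intensity)
  interpret pair_sigma_finite intensity \<nu> ..
  have [measurable_cong]: "sets \<nu> = sets borel" "sets intensity = sets borel"
    using \<nu>(2) by auto
  have space_\<nu>: "space \<nu> = UNIV"
    using sets_eq_imp_space_eq[OF \<nu>(2)] by simp
  have sub: "(\<lambda>f. - f + g) \<in> borel_measurable borel" "(\<lambda>g. - f + g) \<in> borel_measurable borel" for f g :: 'g
    by (intro borel_measurable_continuous_onI continuous_intros)+
  have "(\<lambda>p::'g \<times> 'g. - snd p + fst p) \<in> borel_measurable (borel \<Otimes>\<^sub>M borel)"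
    unfolding borel_prod by (intro borel_measurable_continuous_onI continuous_intros)
  then have "(\<lambda>p. - snd p + fst p) \<in> borel_measurable (intensity \<Otimes>\<^sub>M \<nu>)"
    unfolding measurable_cong_sets[OF sets_pair_measure_cong[OF sets_intensity \<nu>(2)] refl] .
  then have meas: "(\<lambda>(g, f). indicator K (- f + g) :: ennreal) \<in> borel_measurable (intensity \<Otimes>\<^sub>M \<nu>)"
    using K by (simp add: split_beta')
  have \<phi>: "emeasure \<nu> {f. - f + g \<in> K} = (\<integral>\<^sup>+f. indicator K (- f + g) \<partial>\<nu>)" for g
  proof -
    have "{f. - f + g \<in> K} \<in> sets \<nu>"
      using measurable_sets[OF sub(1)[of g] K] \<nu>(2) by (simp add: vimage_def)
    then show ?thesis
      by (simp add: nn_integral_indicator[symmetric] indicator_def of_bool_def)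
  qed
  have "(\<lambda>g. \<integral>\<^sup>+f. indicator K (- f + g) \<partial>\<nu> :: ennreal) \<in> borel_measurable intensity"
    using \<nu>.borel_measurable_nn_integral_fst[OF meas] by simp
  then have \<phi>_meas: "(\<lambda>g. emeasure \<nu> {f. - f + g \<in> K}) \<in> borel_measurable borel"
    unfolding \<phi> by (simp cong: measurable_cong_sets)
  then show "visit_sum (\<lambda>g. emeasure \<nu> {f. - f + g \<in> K}) \<in> borel_measurable (completion M)"
    by (rule Campbell_formula(1))
  have "(\<integral>\<^sup>+x. visit_sum (\<lambda>g. emeasure \<nu> {f. - f + g \<in> K}) x \<partial>completion M)
      = (\<integral>\<^sup>+g. \<integral>\<^sup>+f. indicator K (- f + g) \<partial>\<nu> \<partial>intensity)"
    using Campbell_formula(2)[OF \<phi>_meas] by (simp add: \<phi>)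
  also have "\<dots> = (\<integral>\<^sup>+f. \<integral>\<^sup>+g. indicator K (- f + g) \<partial>intensity \<partial>\<nu>)"
    using Fubini[OF meas] by simp
  also have "\<dots> = (\<integral>\<^sup>+f. emeasure intensity K \<partial>\<nu>)"
  proof (rule nn_integral_cong)
    fix f
    have vim: "{g. - f + g \<in> K} = (\<lambda>g. f + g) ` K"
      by (auto simp: image_iff add.assoc[symmetric]) (metis add.assoc add.right_inverse add_0)
    have "{g. - f + g \<in> K} \<in> sets intensity"
      using measurable_sets[OF sub(2)[of f] K] by (simp add: vimage_def)
    then have "(\<integral>\<^sup>+g. indicator K (- f + g) \<partial>intensity) = emeasure intensity {g. - f + g \<in> K}"
      by (simp add: nn_integral_indicator[symmetric] indicator_def of_bool_def)
    also have "\<dots> = emeasure intensity K"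
      unfolding vim
      by (rule unimodular_imp_left_invariant[OF uni sets_intensity intensity_compact intensity_right_invariant K])
    finally show "(\<integral>\<^sup>+g. indicator K (- f + g) \<partial>intensity) = emeasure intensity K" .
  qed
  also have "\<dots> = emeasure \<nu> UNIV * emeasure intensity K"
    by (simp add: space_\<nu> mult.commute)
  finally show "(\<integral>\<^sup>+x. visit_sum (\<lambda>g. emeasure \<nu> {f. - f + g \<in> K}) x \<partial>completion M)
      = emeasure \<nu> UNIV * emeasure intensity K" .
qed

end

subsection \<open>Approximate lattices and coset spaces\<close>

lemma nowhere_accumulating_imp_locally_finite:
  "nowhere_accumulating \<Lambda> \<Longrightarrow> locally_finite \<Lambda>"
  unfolding nowhere_accumulating_def locally_finite_def
  by (metis Heine_Borel_imp_Bolzano_Weierstrass inf_le1 inf_le2 islimpt_subset)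

lemma compact_set_plus:
  fixes C K :: "'g::topological_monoid_add set"
  assumes "compact C" "compact K"
  shows "compact (C + K)"
proof -
  have "C + K = (\<lambda>p. fst p + snd p) ` (C \<times> K)"
    by (force simp: set_plus_def)
  also have "compact \<dots>"
    by (intro compact_continuous_image compact_Times assms continuous_intros)
  finally show ?thesis .
qed

lemma locally_finite_subset: "locally_finite E \<Longrightarrow> D \<subseteq> E \<Longrightarrow> locally_finite D"
  unfolding locally_finite_def by (meson finite_subset inf_mono order_refl)

lemma locally_finite_plus_finite:
  fixes D :: "'g::topological_group_add set"
  assumes D: "locally_finite D" and F: "finite F"
  shows "locally_finite (D + F)"
  unfolding locally_finite_def
proof (intro allI impI)
  fix K :: "'g set" assume K: "compact K"
  have "compact ((\<lambda>a. a - f) ` K)" for f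
    by (intro compact_continuous_image K continuous_intros)
  then have "finite (\<Union>f\<in>F. (\<lambda>a. a + f) ` (D \<inter> (\<lambda>a. a - f) ` K))"
    using D F unfolding locally_finite_def by blast
  moreover have "(D + F) \<inter> K \<subseteq> (\<Union>f\<in>F. (\<lambda>a. a + f) ` (D \<inter> (\<lambda>a. a - f) ` K))"
  proof
    fix g assume g: "g \<in> (D + F) \<inter> K"
    then obtain d f where df: "d \<in> D" "f \<in> F" "g = d + f"
      by (auto elim: set_plus_elim)
    then have "d = g - f"
      by simp
    with df g show "g \<in> (\<Union>f\<in>F. (\<lambda>a. a + f) ` (D \<inter> (\<lambda>a. a - f) ` K))"
      by blast
  qed
  ultimately show "finite ((D + F) \<inter> K)"
    by (rule rev_finite_subset)
qed

text \<open>Differences of visits turn out to be sums of three elements of \<Lambda>. Two uses of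
  the covering property put such sums into finitely many right translates of \<Lambda>.\<close>

lemma approximate_subgroup_triple_sum:
  fixes \<Lambda> :: "'g::topological_group_add set"
  assumes "approximate_subgroup UNIV \<Lambda>" "nowhere_accumulating \<Lambda>"
  shows "locally_finite (\<Lambda> + (\<Lambda> + \<Lambda>))"
proof -
  obtain F where F: "finite F" "\<Lambda> + \<Lambda> \<subseteq> \<Lambda> + F"
    using assms(1) unfolding approximate_subgroup_def by blast
  have "\<Lambda> + (\<Lambda> + \<Lambda>) \<subseteq> \<Lambda> + (\<Lambda> + F)"
    by (intro set_plus_mono2 F order_refl)
  also have "\<dots> = (\<Lambda> + \<Lambda>) + F"
    by (simp add: add.assoc)
  also have "\<dots> \<subseteq> (\<Lambda> + F) + F"
    by (intro set_plus_mono2 F order_refl)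
  finally show ?thesis
    by (rule locally_finite_subset[rotated])
      (intro locally_finite_plus_finite nowhere_accumulating_imp_locally_finite assms(2) F(1))
qed

lemma locally_finite_imp_countable:
  fixes D :: "'g::second_countable_topology set"
  assumes "locally compact (UNIV :: 'g set)" "locally_finite D"
  shows "countable D"
proof -
  obtain C :: "nat \<Rightarrow> 'g set" where C: "\<forall>n. compact (C n)" "UNIV = (\<Union>n. C n)"
    using open_eq_UN_compact[OF assms(1) open_UNIV] by (elim exE conjE)
  have "D = (\<Union>n. D \<inter> C n)"
    using C(2) by (metis Int_UN_distrib Int_UNIV_right)
  moreover have "countable (D \<inter> C n)" for n
    using C(1) assms(2) unfolding locally_finite_def by (simp add: countable_finite)
  ultimately show ?thesis
    by (metis countable_UN countableI_type)
qed

section \<open>Cosets, visits and hitting times\<close>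

lemma coset_eq_iff:
  assumes "closed_subgroup H"
  shows "coset H g = coset H k \<longleftrightarrow> k \<in> coset H g"
proof
  have "k \<in> coset H k"
    using assms unfolding closed_subgroup_def coset_def by (intro image_eqI[of _ _ 0]) auto
  then show "coset H g = coset H k \<Longrightarrow> k \<in> coset H g"
    by simp
next
  assume "k \<in> coset H g"
  then obtain h where h: "h \<in> H" "k = h + g"
    unfolding coset_def by blast
  have H: "a + b \<in> H" "- a \<in> H" if "a \<in> H" "b \<in> H" for a b
    using assms that unfolding closed_subgroup_def by auto
  show "coset H g = coset H k"
  proof (intro subset_antisym subsetI)
    fix a assume "a \<in> coset H g"
    then obtain b where b: "b \<in> H" "a = b + g"
      unfolding coset_def by blast
    have "a = (b + - h) + k"
      unfolding b(2) h(2) by (simp add: add.assoc[symmetric] del: add_uminus_conv_diff) (simp add: add.assoc)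
    then show "a \<in> coset H k"
      unfolding coset_def using H b(1) h(1) by blast
  next
    fix a assume "a \<in> coset H k"
    then obtain b where b: "b \<in> H" "a = b + k"
      unfolding coset_def by blast
    have "a = (b + h) + g"
      unfolding b(2) h(2) by (simp add: add.assoc)
    then show "a \<in> coset H g"
      unfolding coset_def using H b(1) h(1) by blast
  qed
qed

text \<open>The coset map is open, since the preimage of the image of \<open>W\<close> is the union
  of the translates \<open>h + W\<close>. Images of open sets contained in compact ones therefore
  form an open cover of \<open>L\<close>; the compact sets belonging to a finite subcover make up
  \<open>K\<close>.\<close>

lemma compactin_coset_lift:
  fixes H :: "'g::{topological_group_add, second_countable_topology} set"
  assumes lc: "locally compact (UNIV :: 'g set)" and H: "closed_subgroup H"
    and L: "compactin (coset_topology H) L"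
  obtains K where "compact K" "L \<subseteq> coset H ` K"
proof -
  define \<U> where "\<U> = {coset H ` W | W. open W \<and> (\<exists>K. compact K \<and> W \<subseteq> K)}"
  have "openin (coset_topology H) (coset H ` W)" if "open W" for W
  proof -
    have "coset H -` (coset H ` W) = (\<Union>h\<in>H. (\<lambda>a. - h + a) -` W)"
    proof (intro subset_antisym subsetI)
      fix a assume "a \<in> coset H -` (coset H ` W)"
      then obtain w where w: "w \<in> W" "coset H w = coset H a"
        by force
      then obtain h where h: "h \<in> H" "a = h + w"
        using coset_eq_iff[OF H] unfolding coset_def by blast
      then have "- h + a \<in> W"
        using w(1) by simp
      with h(1) show "a \<in> (\<Union>h\<in>H. (\<lambda>a. - h + a) -` W)"
        by blast
    next
      fix a assume "a \<in> (\<Union>h\<in>H. (\<lambda>a. - h + a) -` W)"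
      then obtain h where h: "h \<in> H" "- h + a \<in> W"
        by blast
      have "a = h + (- h + a)"
        by (simp add: add.assoc[symmetric])
      then have "a \<in> coset H (- h + a)"
        using h(1) unfolding coset_def by blast
      then have "coset H (- h + a) = coset H a"
        using coset_eq_iff[OF H] by blast
      with h(2) show "a \<in> coset H -` (coset H ` W)"
        by (metis image_eqI vimageI)
    qed
    also have "open \<dots>"
      using that by (intro open_UN ballI open_vimage continuous_intros)
    finally show ?thesis
      by (auto simp: openin_coset_topology)
  qed
  then have "\<forall>U\<in>\<U>. openin (coset_topology H) U"
    unfolding \<U>_def by blast
  moreover have "L \<subseteq> \<Union>\<U>"
  proof
    fix s assume "s \<in> L"
    then have "s \<in> range (coset H)"
      using L unfolding compactin_def topspace_coset_topology by blast
    then obtain g where g: "s = coset H g"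
      by blast
    obtain U K where U: "open U" "compact K" "g \<in> U" "U \<subseteq> K"
      by (rule compact_neighbourhood[OF lc open_UNIV UNIV_I])
    have "coset H ` U \<in> \<U>"
      unfolding \<U>_def using U by blast
    with U(3) show "s \<in> \<Union>\<U>"
      unfolding g by blast
  qed
  ultimately obtain \<F> where \<F>: "finite \<F>" "\<F> \<subseteq> \<U>" "L \<subseteq> \<Union>\<F>"
    using L unfolding compactin_def by metis
  have "\<exists>K. compact K \<and> U \<subseteq> coset H ` K" if "U \<in> \<F>" for U
  proof -
    have "U \<in> \<U>"
      using \<F>(2) that by (rule subsetD)
    then obtain W K where "U = coset H ` W" "compact K" "W \<subseteq> K"
      unfolding \<U>_def by auto
    then show ?thesis
      by (intro exI[of _ K]) auto
  qed
  then have "\<forall>U\<in>\<F>. \<exists>K. compact K \<and> U \<subseteq> coset H ` K"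
    by (rule ballI)
  from bchoice[OF this] obtain k where k: "\<forall>U\<in>\<F>. compact (k U) \<and> U \<subseteq> coset H ` k U"
    by (elim exE)
  show ?thesis
  proof (rule that)
    show "compact (\<Union>U\<in>\<F>. k U)"
      using k \<F>(1) by (intro compact_UN) auto
    show "L \<subseteq> coset H ` (\<Union>U\<in>\<F>. k U)"
    proof
      fix s assume "s \<in> L"
      then obtain U where U: "U \<in> \<F>" "s \<in> U"
        using \<F>(3) by blast
      then have "s \<in> coset H ` k U"
        using k by blast
      with U(1) show "s \<in> coset H ` (\<Union>U\<in>\<F>. k U)"
        by auto
    qed
  qed
qed

text \<open>If \<open>g\<close> and \<open>h\<close> bring \<open>x\<close> to
  \<open>act \<gamma> z\<close> and \<open>act \<delta> w\<close>, then \<open>g - h\<close> is the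
  sum of \<open>\<gamma>\<close>, a return time from \<open>w\<close> to \<open>z\<close>, and
  \<open>- \<delta>\<close>. The saturation is measurable because \<Gamma> is countable.\<close>

lemma visits_saturation:
  fixes \<Lambda> :: "'g::{topological_group_add, second_countable_topology, t2_space} set"
  assumes lc: "locally compact (UNIV :: 'g set)"
    and sys: "separated_transverse_system act Z \<mu>"
    and \<Lambda>: "approximate_lattice UNIV \<Lambda>" "return_times act Z \<subseteq> \<Lambda>"
    and \<Gamma>: "\<Gamma> \<subseteq> \<Lambda>"
  shows "locally_finite_visits \<mu> act (saturation act \<Gamma> Z) (\<Lambda> + (\<Lambda> + \<Lambda>))"
proof -
  have action: "borel_action act \<mu>" and Z: "Z \<in> sets \<mu>" and prob: "prob_space \<mu>"
    using sys unfolding separated_transverse_system_def by auto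
  have approx: "approximate_subgroup UNIV \<Lambda>" "nowhere_accumulating \<Lambda>"
    using \<Lambda>(1) unfolding approximate_lattice_def by auto
  have sym: "- a \<in> \<Lambda>" if "a \<in> \<Lambda>" for a
    using approx(1) that unfolding approximate_subgroup_def by (metis imageI)
  have act0: "act 0 x = x" and act_add: "act (g + h) x = act g (act h x)" if "x \<in> space \<mu>" for g h x
    using action that unfolding borel_action_def by auto
  have act_meas: "act g \<in> \<mu> \<rightarrow>\<^sub>M \<mu>" for g
    using action measurable_compose[OF measurable_Pair1'[of g borel \<mu>]]
    unfolding borel_action_def by fastforce
  have Z_space: "z \<in> space \<mu>" if "z \<in> Z" for z
    using Z that sets.sets_into_space by blast
  have "countable \<Gamma>"
    using locally_finite_imp_countable[OF lc nowhere_accumulating_imp_locally_finite[OF approx(2)]] \<Gamma>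
      countable_subset by blast
  have undo: "act (- \<gamma> + g) x = z" if "act g x = act \<gamma> z" "x \<in> space \<mu>" "z \<in> Z" for \<gamma> g x z
    using that act_add[of x "- \<gamma>" g] act_add[of z "- \<gamma>" \<gamma>] act0[of z] Z_space by simp
  interpret prob_space \<mu> by (rule prob)
  show ?thesis
  proof
    show "saturation act \<Gamma> Z \<in> sets \<mu>"
    proof -
      have "saturation act \<Gamma> Z = (\<Union>\<gamma>\<in>\<Gamma>. act (- \<gamma>) -` Z \<inter> space \<mu>)"
      proof (intro subset_antisym subsetI)
        fix x assume "x \<in> saturation act \<Gamma> Z"
        then obtain \<gamma> z where \<gamma>: "\<gamma> \<in> \<Gamma>" "z \<in> Z" "x = act \<gamma> z"
          unfolding saturation_def by blast
        have "x \<in> space \<mu>"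
          using \<gamma> measurable_space[OF act_meas] Z_space by blast
        moreover have "act (- \<gamma>) x = z"
          using undo[of 0 x \<gamma> z] act0 \<gamma> \<open>x \<in> space \<mu>\<close> by simp
        ultimately show "x \<in> (\<Union>\<gamma>\<in>\<Gamma>. act (- \<gamma>) -` Z \<inter> space \<mu>)"
          using \<gamma> by blast
      next
        fix x assume "x \<in> (\<Union>\<gamma>\<in>\<Gamma>. act (- \<gamma>) -` Z \<inter> space \<mu>)"
        then obtain \<gamma> where \<gamma>: "\<gamma> \<in> \<Gamma>" "act (- \<gamma>) x \<in> Z" "x \<in> space \<mu>"
          by blast
        have "x = act \<gamma> (act (- \<gamma>) x)"
          using act_add[OF \<gamma>(3), of \<gamma> "- \<gamma>"] act0[OF \<gamma>(3)] by simp
        with \<gamma> show "x \<in> saturation act \<Gamma> Z"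
          unfolding saturation_def by blast
      qed
      also have "\<dots> \<in> sets \<mu>"
        using measurable_sets[OF act_meas Z]
        by (intro sets.countable_UN'[OF \<open>countable \<Gamma>\<close>]) blast
      finally show ?thesis .
    qed
    fix x g h assume x: "x \<in> space \<mu>" "act g x \<in> saturation act \<Gamma> Z" "act h x \<in> saturation act \<Gamma> Z"
    then obtain \<gamma> z \<delta> w where z: "\<gamma> \<in> \<Gamma>" "z \<in> Z" "act g x = act \<gamma> z"
      and w: "\<delta> \<in> \<Gamma>" "w \<in> Z" "act h x = act \<delta> w"
      unfolding saturation_def by blast
    define r where "r = (- \<gamma> + g) - (- \<delta> + h)"
    have "r + (- \<delta> + h) = - \<gamma> + g"
      unfolding r_def by simp
    then have "act r w = z"
      using act_add[OF x(1), of r "- \<delta> + h"] undo[OF z(3) x(1) z(2)] undo[OF w(3) x(1) w(2)] by simp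
    then have "r \<in> \<Lambda>"
      using \<Lambda>(2) z(2) w(2) unfolding return_times_def by blast
    moreover have "g - h = \<gamma> + (r + - \<delta>)"
      unfolding r_def by (simp add: minus_add add.assoc diff_conv_add_uminus del: add_uminus_conv_diff)
    moreover have "\<gamma> \<in> \<Lambda>" "- \<delta> \<in> \<Lambda>"
      using \<Gamma> z(1) w(1) sym by auto
    ultimately show "g - h \<in> \<Lambda> + (\<Lambda> + \<Lambda>)"
      by (simp only: set_plus_intro)
  next
    show "distr \<mu> \<mu> (act g) = \<mu>" for g
      using sys unfolding separated_transverse_system_def by blast
  qed (use lc action approximate_subgroup_triple_sum[OF approx] in auto)
qed

text \<open>A hitting coset has two relevant representatives: \<open>z\<close>, which brings
  \<open>x\<close> into the cross section itself, and \<open>h + z\<close>, which lies in the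
  compact set \<open>K\<close>. Nothing bounds the element \<open>h\<close> between them;
  compensating for it is where the approximate lattice in \<open>H\<close> comes in.\<close>

lemma hitting_time_representative:
  assumes H: "closed_subgroup H" and action: "borel_action act \<mu>" and Z: "Z \<subseteq> space \<mu>"
    and x: "x \<in> space \<mu>" and L: "L \<subseteq> coset H ` K"
    and s: "s \<in> hitting_times act H (saturation act H Z) x \<inter> L"
  obtains z h where "h \<in> H" "s = coset H z" "act z x \<in> Z" "h + z \<in> K"
proof -
  obtain g k h0 z0 where g: "s = coset H g" "h0 \<in> H" "z0 \<in> Z" "act g x = act h0 z0"
    and k: "s = coset H k" "k \<in> K"
    using s L unfolding hitting_times_def saturation_def by blast
  have "- h0 \<in> H"
    using H g(2) unfolding closed_subgroup_def by blast
  then have "- h0 + g \<in> coset H g"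
    unfolding coset_def by blast
  then have s_eq: "s = coset H (- h0 + g)"
    using coset_eq_iff[OF H] g(1) by blast
  have "act (- h0 + g) x = act (- h0) (act h0 z0)"
    using action x unfolding borel_action_def g(4)[symmetric] by simp
  also have "\<dots> = z0"
    using action Z g(3) unfolding borel_action_def by (metis add.left_inverse subsetD)
  finally have "act (- h0 + g) x \<in> Z"
    using g(3) by simp
  moreover obtain h where "h \<in> H" "k = h + (- h0 + g)"
    using coset_eq_iff[OF H, of "- h0 + g" k] k(1) s_eq unfolding coset_def by auto
  ultimately show ?thesis
    using that s_eq k(2) by blast
qed

subsection \<open>Integrability\<close>

text \<open>\<open>H\<close> is a countable union of compact sets, and these cannot all be null
  since \<open>H\<close> is not.\<close>

lemma haar_measure_compact_pos:
  fixes H :: "'g::{topological_group_add, second_countable_topology, t2_space} set"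
  assumes lc: "locally compact (UNIV :: 'g set)" and H: "closed_subgroup H"
    and m: "left_haar_measure H m"
  obtains C where "compact C" "C \<subseteq> H" "C \<in> sets m" "0 < emeasure m C" "emeasure m C < \<infinity>"
proof -
  obtain K :: "nat \<Rightarrow> 'g set" where K: "\<forall>n. compact (K n)" "UNIV = (\<Union>n. K n)"
    using open_eq_UN_compact[OF lc open_UNIV] by (elim exE conjE)
  have "closed H"
    using H unfolding closed_subgroup_def by blast
  then have HK: "compact (H \<inter> K n)" for n
    using K(1) by (simp add: closed_Int_compact)
  have sets_HK: "H \<inter> K n \<in> sets m" for n
    using m HK \<open>closed H\<close> unfolding left_haar_measure_def
    by (auto simp: sets_restrict_space_iff borel_compact borel_closed)
  have "(\<Union>n. H \<inter> K n) = H \<inter> (\<Union>n. K n)"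
    by auto
  then have cover: "(\<Union>n. H \<inter> K n) = H"
    by (simp only: K(2)[symmetric] Int_UNIV_right)
  have "\<exists>n. emeasure m (H \<inter> K n) \<noteq> 0"
  proof (rule ccontr)
    assume "\<nexists>n. emeasure m (H \<inter> K n) \<noteq> 0"
    then have "(\<Union>n. H \<inter> K n) \<in> null_sets m"
      using sets_HK by (intro null_sets_UN) auto
    then show False
      using m unfolding cover left_haar_measure_def by (simp add: null_setsD1)
  qed
  then obtain n where "emeasure m (H \<inter> K n) \<noteq> 0"
    by blast
  then show ?thesis
    using that[OF HK, of n] sets_HK[of n] m HK[of n] unfolding left_haar_measure_def
    by (simp add: zero_less_iff_neq_zero)
qed

text \<open>If \<open>h + z\<close> lies in \<open>K\<close>, then all \<open>a\<close> in a left translate of \<open>C\<close> satisfy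
  \<open>- a + z \<in> - C + K\<close>.  The translates \<open>\<gamma> + F\<close> cover \<open>H\<close>, and shifting the part of this
  set inside \<open>\<gamma> + F\<close> back to \<open>F\<close> replaces \<open>z\<close> by \<open>- \<gamma> + z\<close>.\<close>

lemma haar_measure_orbit_sum:
  fixes H :: "'g::{topological_group_add, second_countable_topology, t2_space} set"
  assumes H: "closed_subgroup H" and m: "left_haar_measure H m"
    and \<Gamma>: "countable \<Gamma>" "\<Gamma> \<subseteq> H" "uminus ` \<Gamma> = \<Gamma>"
    and F: "F \<in> sets m" "H = \<Gamma> + F"
    and C: "compact C" "C \<subseteq> H" "C \<in> sets m" and K: "compact K"
    and z: "h \<in> H" "h + z \<in> K"
  shows "emeasure m C \<le> (\<integral>\<^sup>+g. emeasure m (F \<inter> {f. - f + g \<in> uminus ` C + K})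
      * indicator ((\<lambda>\<gamma>. \<gamma> + z) ` \<Gamma>) g \<partial>count_space UNIV)"
proof -
  define K' where "K' = uminus ` C + K"
  have "compact (uminus ` C)"
    by (intro compact_continuous_image C(1) continuous_intros)
  then have "closed K'"
    unfolding K'_def by (intro compact_imp_closed compact_set_plus K)
  have H_ops: "a + b \<in> H" "- a \<in> H" if "a \<in> H" "b \<in> H" for a b
    using H that unfolding closed_subgroup_def by auto
  have "closed H"
    using H unfolding closed_subgroup_def by auto
  have sets_m: "X \<in> sets m \<longleftrightarrow> X \<in> sets borel \<and> X \<subseteq> H" for X
    using m \<open>closed H\<close> unfolding left_haar_measure_def
    by (auto simp: sets_restrict_space_iff borel_closed)
  have shift: "emeasure m ((\<lambda>a. s + a) ` X) = emeasure m X" if "s \<in> H" "X \<in> sets m" for s X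
    using m that unfolding left_haar_measure_def by blast
  have vim: "(\<lambda>a. s + a) ` X = (\<lambda>a. - s + a) -` X" for s :: 'g and X
    by (auto simp: image_iff add.assoc[symmetric]) (metis add.assoc add.right_inverse add_0)
  \<comment> \<open>\<open>A\<close> contains the translate \<open>- h + C\<close>, so by left
    invariance its measure is at least that of \<open>C\<close>.\<close>
  define A where "A = {a \<in> H. - a + z \<in> K'}"
  have "closed {a. - a + z \<in> K'}"
    using closed_vimage[OF \<open>closed K'\<close>, of "\<lambda>a. - a + z"] by (simp add: vimage_def continuous_intros)
  then have A_sets: "A \<in> sets m"
    unfolding sets_m A_def using \<open>closed H\<close> by (auto simp: Collect_conj_eq intro!: borel_closed closed_Int)
  have shift_sets: "(\<lambda>a. s + a) ` X \<in> sets m" if "s \<in> H" "X \<in> sets m" for s X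
  proof -
    have "(\<lambda>a. - s + a) \<in> borel_measurable borel"
      by (intro borel_measurable_continuous_onI continuous_intros)
    then have "(\<lambda>a. s + a) ` X \<in> sets borel"
      using measurable_sets[of "\<lambda>a. - s + a" borel borel X] that(2) sets_m vim by simp
    with that show ?thesis
      using H_ops unfolding sets_m by blast
  qed
  have "(\<lambda>a. - h + a) ` C \<subseteq> A"
  proof
    fix a assume "a \<in> (\<lambda>a. - h + a) ` C"
    then obtain c where c: "c \<in> C" "a = - h + c"
      by blast
    have "- a + z = - c + (h + z)"
      unfolding c(2) by (simp add: minus_add add.assoc)
    then have "- a + z \<in> K'"
      unfolding K'_def using c(1) z(2) by (auto intro: set_plus_intro)
    moreover have "a \<in> H"
      unfolding c(2) using H_ops z(1) c(1) C(2) by blast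
    ultimately show "a \<in> A"
      unfolding A_def by blast
  qed
  then have "emeasure m C \<le> emeasure m A"
    using shift[of "- h" C] H_ops(2)[OF z(1) z(1)] C(3) A_sets by (metis emeasure_mono)
  also have "\<dots> = (\<integral>\<^sup>+a. indicator A a \<partial>m)"
    using A_sets by simp
  \<comment> \<open>Every point of \<open>A\<close> lies in at least one translate
    \<open>\<gamma> + F\<close>; overlaps only increase the right-hand side.\<close>
  also have "\<dots> \<le> (\<integral>\<^sup>+a. \<integral>\<^sup>+\<gamma>. indicator (A \<inter> (\<lambda>a. \<gamma> + a) ` F) a \<partial>count_space \<Gamma> \<partial>m)"
  proof (rule nn_integral_mono)
    fix a :: 'g
    show "indicator A a \<le> (\<integral>\<^sup>+\<gamma>. indicator (A \<inter> (\<lambda>a. \<gamma> + a) ` F) a \<partial>count_space \<Gamma> :: ennreal)"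
    proof (cases "a \<in> A")
      case True
      then have "a \<in> \<Gamma> + F"
        using F(2) unfolding A_def by simp
      then obtain \<gamma> f where "\<gamma> \<in> \<Gamma>" "f \<in> F" "a = \<gamma> + f"
        by (elim set_plus_elim)
      with True nn_integral_ge_point[of \<gamma> \<Gamma> "\<lambda>\<gamma>. indicator (A \<inter> (\<lambda>a. \<gamma> + a) ` F) a"] show ?thesis
        by (simp add: indicator_def image_iff split: if_splits)
    qed simp
  qed
  \<comment> \<open>Countability of \<Gamma> allows the sum and the integral to be
    interchanged.\<close>
  also have "\<dots> = (\<integral>\<^sup>+\<gamma>. \<integral>\<^sup>+a. indicator (A \<inter> (\<lambda>a. \<gamma> + a) ` F) a \<partial>m \<partial>count_space \<Gamma>)"
    using \<Gamma> A_sets F(1) shift_sets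
    by (intro nn_integral_count_space_nn_integral borel_measurable_indicator sets.Int) auto
  also have "\<dots> = (\<integral>\<^sup>+\<gamma>. emeasure m (F \<inter> {f. - f + (- \<gamma> + z) \<in> K'}) \<partial>count_space \<Gamma>)"
  proof (rule nn_integral_cong)
    fix \<gamma> assume "\<gamma> \<in> space (count_space \<Gamma>)"
    then have \<gamma>: "\<gamma> \<in> H"
      using \<Gamma>(2) by auto
    have "(\<lambda>a. \<gamma> + a) ` (F \<inter> {f. - f + (- \<gamma> + z) \<in> K'}) = A \<inter> (\<lambda>a. \<gamma> + a) ` F"
    proof -
      have "- (\<gamma> + f) + z = - f + (- \<gamma> + z)" for f
        by (simp add: minus_add add.assoc del: add_uminus_conv_diff)
      moreover have "\<gamma> + f \<in> H" if "f \<in> F" for f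
        using F(1) sets_m H_ops(1)[OF \<gamma>] that by blast
      ultimately have "\<gamma> + f \<in> A \<longleftrightarrow> - f + (- \<gamma> + z) \<in> K'" if "f \<in> F" for f
        unfolding A_def using that by simp
      then show ?thesis
        by blast
    qed
    moreover have "F \<inter> {f. - f + (- \<gamma> + z) \<in> K'} \<in> sets m"
    proof -
      have "closed {f. - f + (- \<gamma> + z) \<in> K'}"
        using closed_vimage[OF \<open>closed K'\<close>, of "\<lambda>f. - f + (- \<gamma> + z)"]
        by (simp add: vimage_def continuous_intros)
      then show ?thesis
        using F(1) unfolding sets_m by (auto intro: borel_closed)
    qed
    ultimately show "(\<integral>\<^sup>+a. indicator (A \<inter> (\<lambda>a. \<gamma> + a) ` F) a \<partial>m)
        = emeasure m (F \<inter> {f. - f + (- \<gamma> + z) \<in> K'})"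
      using shift[OF \<gamma>] shift_sets[OF \<gamma>] A_sets F(1) by (metis nn_integral_indicator)
  qed
  \<comment> \<open>The sum runs over the points \<open>- \<gamma> + z\<close>; by symmetry of
    \<Gamma> these are the points \<open>\<gamma> + z\<close>.\<close>
  also have "\<dots> = (\<integral>\<^sup>+g. emeasure m (F \<inter> {f. - f + g \<in> K'}) \<partial>count_space ((\<lambda>\<gamma>. \<gamma> + z) ` \<Gamma>))"
  proof (rule nn_integral_bij_count_space)
    have "inj_on (\<lambda>\<gamma>. - \<gamma> + z) \<Gamma>"
      by (auto intro: inj_onI)
    moreover have "(\<lambda>\<gamma>. - \<gamma> + z) ` \<Gamma> = (\<lambda>\<gamma>. \<gamma> + z) ` uminus ` \<Gamma>"
      by (simp add: image_image)
    ultimately show "bij_betw (\<lambda>\<gamma>. - \<gamma> + z) \<Gamma> ((\<lambda>\<gamma>. \<gamma> + z) ` \<Gamma>)"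
      unfolding bij_betw_def \<Gamma>(3) by blast
  qed
  finally show ?thesis
    unfolding K'_def by (simp add: nn_integral_count_space_indicator)
qed

text \<open>Distinct cosets are disjoint, so a visit is charged to at most one coset when the
  contributions of several cosets are added up.\<close>

lemma sum_indicator_cosets_le_1:
  assumes H: "closed_subgroup H" and "finite S" "S \<subseteq> range (coset H)"
  shows "(\<Sum>s\<in>S. indicator s g) \<le> (1::ennreal)"
proof -
  have "indicator s g \<le> (if s = coset H g then 1 else 0 :: ennreal)" if "s \<in> S" for s
    using that assms(3) coset_eq_iff[OF H] by (auto split: split_indicator)
  then have "(\<Sum>s\<in>S. indicator s g) \<le> (\<Sum>s\<in>S. if s = coset H g then 1 else 0 :: ennreal)"
    by (rule sum_mono)
  also have "\<dots> \<le> 1"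
    using assms(2) by simp
  finally show ?thesis .
qed

text \<open>Finiteness of \<open>A\<close> is not known in advance, so the bound is asked of finite
  subsets only; an infinite \<open>A\<close> has arbitrarily large ones, which forces
  \<open>V\<close> to be infinite.\<close>

lemma cardinality_power_1_le:
  fixes c V :: ennreal
  assumes bound: "\<And>S. finite S \<Longrightarrow> S \<subseteq> A \<Longrightarrow> of_nat (card S) * c \<le> V" and c: "0 < c"
  shows "cardinality_power A 1 * c \<le> V"
proof (cases "finite A")
  case True
  with bound[of A] show ?thesis
    by (simp add: cardinality_power_def ennreal_of_nat_eq_real_of_nat)
next
  case False
  have "of_nat n * c \<le> V" for n
    using bound infinite_arbitrarily_large[OF False, of n] by metis
  then have "(SUP n. of_nat n * c) \<le> V"
    by (rule SUP_least)
  then have "(SUP n. of_nat n :: ennreal) * c \<le> V"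
    by (simp add: SUP_mult_right_ennreal)
  with c False show ?thesis
    by (simp add: cardinality_power_def ennreal_SUP_of_nat_eq_top)
qed

lemma saturation_act:
  assumes "borel_action act \<mu>" "x \<in> space \<mu>" "act z x \<in> Z" "\<gamma> \<in> \<Gamma>"
  shows "act (\<gamma> + z) x \<in> saturation act \<Gamma> Z"
  using assms unfolding borel_action_def saturation_def by auto

section \<open>Integrability in the case of finite covolume\<close>

lemma integrable_if_compatible_pair:
  fixes act :: "'g::{topological_group_add, second_countable_topology, t2_space} \<Rightarrow> 'x \<Rightarrow> 'x"
  assumes lc: "locally compact (UNIV :: 'g set)" and uni: "unimodular (UNIV :: 'g set)"
    and H: "closed_subgroup H" and sys: "separated_transverse_system act Z \<mu>"
    and \<Lambda>: "compatible_pair H \<Lambda>" "return_times act Z \<subseteq> \<Lambda>"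
  shows "transverse_integrable act H (saturation act H Z) \<mu> 1"
proof -
  define \<Gamma> where "\<Gamma> = \<Lambda> \<inter> H"
  have approx: "approximate_lattice UNIV \<Lambda>" "approximate_lattice H \<Gamma>"
    using \<Lambda>(1) unfolding compatible_pair_def \<Gamma>_def by auto
  have action: "borel_action act \<mu>" and Z: "Z \<subseteq> space \<mu>"
    using sys sets.sets_into_space unfolding separated_transverse_system_def by auto
  interpret locally_finite_visits \<mu> act "saturation act \<Gamma> Z" "\<Lambda> + (\<Lambda> + \<Lambda>)"
    by (rule visits_saturation[OF lc sys approx(1) \<Lambda>(2)]) (simp add: \<Gamma>_def)
  obtain m F where m: "left_haar_measure H m" and F: "F \<in> sets m" "emeasure m F < \<infinity>" "H = \<Gamma> + F"
    using approx(2) unfolding approximate_lattice_def finite_covolume_def by blast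
  have \<Gamma>: "\<Gamma> \<subseteq> H" "uminus ` \<Gamma> = \<Gamma>"
    using approx(2) unfolding approximate_lattice_def approximate_subgroup_def by auto
  have "countable \<Gamma>"
    using approx(2) unfolding approximate_lattice_def
    by (intro locally_finite_imp_countable[OF lc] nowhere_accumulating_imp_locally_finite) blast
  obtain C where C: "compact C" "C \<subseteq> H" "C \<in> sets m" "0 < emeasure m C" "emeasure m C < \<infinity>"
    by (rule haar_measure_compact_pos[OF lc H m])
  have sets_m: "sets m = sets (restrict_space borel H)"
    using m unfolding left_haar_measure_def by blast
  have F_space: "F \<inter> space m \<in> sets m"
    using F(1) by auto
  \<comment> \<open>\<open>m\<close> lives on the Borel sets of \<open>H\<close> alone;
    \<open>\<nu>\<close> is its restriction to \<open>F\<close>, viewed as a finite Borel measure on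
    the whole group.\<close>
  define \<nu> where "\<nu> = distr (restrict_space m F) borel (\<lambda>a. a)"
  have id_meas: "(\<lambda>a. a) \<in> borel_measurable (restrict_space m F)"
    unfolding measurable_cong_sets[OF sets_restrict_space_cong[OF sets_m] refl]
    by (intro measurable_restrict_space1) simp
  have \<nu>: "emeasure \<nu> B = emeasure m (F \<inter> B)" if "B \<in> sets borel" for B
  proof -
    have "emeasure \<nu> B = emeasure (restrict_space m F) (B \<inter> F)"
      using sets.sets_into_space[OF F(1)] unfolding \<nu>_def
      by (subst emeasure_distr[OF id_meas that]) (simp add: space_restrict_space Int_absorb2)
    also have "\<dots> = emeasure m (F \<inter> B)"
      using F_space by (subst emeasure_restrict_space) (auto simp: Int_commute)
    finally show ?thesis .
  qed
  have fin_\<nu>: "finite_measure \<nu>"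
    using \<nu>[of UNIV] F(2) by (intro finite_measureI) (simp add: \<nu>_def)
  show ?thesis
    unfolding transverse_integrable_def
  proof (intro allI impI)
    fix L assume "compactin (coset_topology H) L"
    then obtain K where K: "compact K" "L \<subseteq> coset H ` K"
      by (rule compactin_coset_lift[OF lc H])
    define K' where "K' = uminus ` C + K"
    have K': "compact K'"
      unfolding K'_def by (intro compact_set_plus compact_continuous_image C K continuous_intros)
    define \<phi> where "\<phi> g = emeasure \<nu> {f. - f + g \<in> K'}" for g
    have \<phi>_eq: "\<phi> g = emeasure m (F \<inter> {f. - f + g \<in> K'})" for g
    proof -
      have "closed {f. - f + g \<in> K'}"
        using closed_vimage[OF compact_imp_closed[OF K'], of "\<lambda>f. - f + g"]
        by (simp add: vimage_def continuous_intros)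
      then show ?thesis
        unfolding \<phi>_def by (intro \<nu> borel_closed)
    qed
    have V: "visit_sum \<phi> \<in> borel_measurable (completion \<mu>)"
        "(\<integral>\<^sup>+x. visit_sum \<phi> x \<partial>completion \<mu>) = emeasure \<nu> UNIV * emeasure intensity K'"
      using nn_integral_visit_sum_translates[OF uni fin_\<nu> _ borel_compact[OF K']]
      unfolding \<phi>_def by (simp_all add: \<nu>_def)
    \<comment> \<open>Each hitting coset is charged with the part of the visit sum that comes from
      visits inside it. That part is at least \<open>emeasure m C\<close>, because the points
      \<open>\<gamma> + z\<close> are visits in the coset.\<close>
    have le: "cardinality_power (hitting_times act H (saturation act H Z) x \<inter> L) 1 * emeasure m C
        \<le> visit_sum \<phi> x" if x: "x \<in> space \<mu>" for x
    proof (rule cardinality_power_1_le[OF _ C(4)])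
      fix S assume S: "finite S" "S \<subseteq> hitting_times act H (saturation act H Z) x \<inter> L"
      have coset_le: "emeasure m C
          \<le> (\<integral>\<^sup>+g. \<phi> g * indicator (visits x) g * indicator s g \<partial>count_space UNIV)" if s: "s \<in> S" for s
      proof -
        obtain z h where z: "h \<in> H" "s = coset H z" "act z x \<in> Z" "h + z \<in> K"
          by (rule hitting_time_representative[OF H action Z x K(2) subsetD[OF S(2) s]])
        have orbit: "(\<lambda>\<gamma>. \<gamma> + z) ` \<Gamma> \<subseteq> visits x \<inter> s"
          unfolding visits_def z(2) coset_def using \<Gamma>(1) saturation_act[OF action x z(3)] by auto
        have "emeasure m C \<le> (\<integral>\<^sup>+g. \<phi> g * indicator ((\<lambda>\<gamma>. \<gamma> + z) ` \<Gamma>) g \<partial>count_space UNIV)"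
          using haar_measure_orbit_sum[OF H m \<open>countable \<Gamma>\<close> \<Gamma> F(1,3) C(1-3) K(1) z(1,4)]
          unfolding \<phi>_eq K'_def .
        also have "\<dots> \<le> (\<integral>\<^sup>+g. \<phi> g * indicator (visits x) g * indicator s g \<partial>count_space UNIV)"
          using orbit by (intro nn_integral_mono) (auto split: split_indicator)
        finally show ?thesis .
      qed
      have "of_nat (card S) * emeasure m C = (\<Sum>s\<in>S. emeasure m C)"
        by simp
      also have "\<dots> \<le> (\<Sum>s\<in>S. \<integral>\<^sup>+g. \<phi> g * indicator (visits x) g * indicator s g \<partial>count_space UNIV)"
        by (intro sum_mono coset_le)
      also have "\<dots> = (\<integral>\<^sup>+g. (\<Sum>s\<in>S. \<phi> g * indicator (visits x) g * indicator s g) \<partial>count_space UNIV)"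
        by (intro nn_integral_sum[symmetric]) simp
      also have "\<dots> \<le> visit_sum \<phi> x"
        unfolding visit_sum_def sum_distrib_left[symmetric]
      proof (rule nn_integral_mono)
        fix g
        have "S \<subseteq> range (coset H)"
          using S(2) unfolding hitting_times_def by blast
        then have "\<phi> g * indicator (visits x) g * (\<Sum>s\<in>S. indicator s g) \<le> \<phi> g * indicator (visits x) g * 1"
          by (intro mult_left_mono sum_indicator_cosets_le_1[OF H S(1)]) auto
        then show "\<phi> g * indicator (visits x) g * (\<Sum>s\<in>S. indicator s g) \<le> \<phi> g * indicator (visits x) g"
          by simp
      qed
      finally show "of_nat (card S) * emeasure m C \<le> visit_sum \<phi> x" .
    qed
    have "cardinality_power (hitting_times act H (saturation act H Z) x \<inter> L) 1
        \<le> visit_sum \<phi> x / emeasure m C" if "x \<in> space \<mu>" for x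
      using divide_right_mono_ennreal[OF le[OF that], of "emeasure m C"] C(4,5)
      by (simp add: ennreal_mult_divide_eq)
    then have "(\<integral>\<^sup>+x. cardinality_power (hitting_times act H (saturation act H Z) x \<inter> L) 1 \<partial>\<mu>)
        \<le> (\<integral>\<^sup>+x. visit_sum \<phi> x / emeasure m C \<partial>\<mu>)"
      by (rule nn_integral_mono)
    \<comment> \<open>Over the completion \<open>visit_sum \<phi>\<close> is measurable, so the
      constant divisor can be taken out of the integral.\<close>
    also have "\<dots> = (\<integral>\<^sup>+x. visit_sum \<phi> x / emeasure m C \<partial>completion \<mu>)"
      by (simp add: nn_integral_completion)
    also have "\<dots> = emeasure \<nu> UNIV * emeasure intensity K' / emeasure m C"
      using V by (simp add: nn_integral_divide)
    also have "\<dots> < \<infinity>"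
      using finite_measure.emeasure_finite[OF fin_\<nu>, of UNIV] intensity_compact[OF K'] C(4)
      by (simp add: ennreal_divide_eq_top_iff ennreal_mult_eq_top_iff less_top[symmetric]
          zero_less_iff_neq_zero)
    finally show "if (1::ennreal) = \<infinity>
        then \<exists>C::nat. AE x in \<mu>. finite (hitting_times act H (saturation act H Z) x \<inter> L) \<and>
          card (hitting_times act H (saturation act H Z) x \<inter> L) \<le> C
        else (\<integral>\<^sup>+x. cardinality_power (hitting_times act H (saturation act H Z) x \<inter> L) (enn2real 1) \<partial>\<mu>) < \<infinity>"
      by simp
  qed
qed

section \<open>Bounded hitting numbers in the uniform case\<close>

lemma integrable_if_uniform_compatible_pair:
  fixes act :: "'g::{topological_group_add, second_countable_topology, t2_space} \<Rightarrow> 'x \<Rightarrow> 'x"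
  assumes lc: "locally compact (UNIV :: 'g set)"
    and H: "closed_subgroup H" and sys: "separated_transverse_system act Z \<mu>"
    and \<Lambda>: "uniform_compatible_pair H \<Lambda>" "return_times act Z \<subseteq> \<Lambda>"
  shows "transverse_integrable act H (saturation act H Z) \<mu> p"
proof -
  define \<Gamma> where "\<Gamma> = \<Lambda> \<inter> H"
  have approx: "approximate_lattice UNIV \<Lambda>" "approximate_lattice H \<Gamma>"
    and "relatively_dense H \<Gamma>"
    using \<Lambda>(1) unfolding uniform_compatible_pair_def uniform_approximate_lattice_def \<Gamma>_def by auto
  then obtain C where C: "C \<subseteq> H" "compact C" "H = \<Gamma> + C"
    unfolding relatively_dense_def by blast
  have action: "borel_action act \<mu>" and Z: "Z \<subseteq> space \<mu>"
    using sys sets.sets_into_space unfolding separated_transverse_system_def by auto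
  interpret locally_finite_visits \<mu> act "saturation act \<Gamma> Z" "\<Lambda> + (\<Lambda> + \<Lambda>)"
    by (rule visits_saturation[OF lc sys approx(1) \<Lambda>(2)]) (simp add: \<Gamma>_def)
  have \<Gamma>_H: "\<Gamma> \<subseteq> H" and \<Gamma>_minus: "uminus ` \<Gamma> = \<Gamma>"
    using approx(2) unfolding approximate_lattice_def approximate_subgroup_def by auto
  have \<Gamma>: "- \<gamma> \<in> \<Gamma>" "- \<gamma> \<in> H" if "\<gamma> \<in> \<Gamma>" for \<gamma>
    using that \<Gamma>_H \<Gamma>_minus by blast+
  show ?thesis
    unfolding transverse_integrable_def
  proof (intro allI impI)
    fix L assume "compactin (coset_topology H) L"
    then obtain K where K: "compact K" "L \<subseteq> coset H ` K"
      by (rule compactin_coset_lift[OF lc H])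
    obtain c where c: "\<And>x. x \<in> space \<mu> \<Longrightarrow> finite (visits x \<inter> (C + K)) \<and> card (visits x \<inter> (C + K)) \<le> c"
      using visits_card[OF compact_set_plus[OF C(2) K(1)]] by blast
    have bound: "finite (hitting_times act H (saturation act H Z) x \<inter> L) \<and>
        card (hitting_times act H (saturation act H Z) x \<inter> L) \<le> c" if x: "x \<in> space \<mu>" for x
    proof -
      have "hitting_times act H (saturation act H Z) x \<inter> L \<subseteq> coset H ` (visits x \<inter> (C + K))"
      proof
        fix s assume "s \<in> hitting_times act H (saturation act H Z) x \<inter> L"
        then obtain z h where z: "h \<in> H" "s = coset H z" "act z x \<in> Z" "h + z \<in> K"
          by (rule hitting_time_representative[OF H action Z x K(2)])
        \<comment> \<open>Decomposing \<open>- h\<close> rather than \<open>h\<close> gives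
          \<open>- \<gamma> + z = d + (h + z)\<close>. The left side is a visit in the coset by
          symmetry of \<Gamma>, and the right side lies in the compact set \<open>C + K\<close>,
          where the number of visits is at most \<open>c\<close>.\<close>
        have "- h \<in> \<Gamma> + C"
          using H z(1) C(3) unfolding closed_subgroup_def by blast
        then obtain \<gamma> d where d: "\<gamma> \<in> \<Gamma>" "d \<in> C" "- h = \<gamma> + d"
          by (elim set_plus_elim)
        have "- \<gamma> + z = d + (h + z)"
        proof -
          have "h = - d + - \<gamma>"
            using d(3) by (metis minus_add minus_minus)
          then show ?thesis
            by (simp add: add.assoc[symmetric] del: add_uminus_conv_diff)
        qed
        then have "- \<gamma> + z \<in> C + K"
          using d(2) z(4) by (auto intro: set_plus_intro)
        moreover have "- \<gamma> + z \<in> visits x"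
          unfolding visits_def using saturation_act[OF action x z(3) \<Gamma>(1)[OF d(1)]] by simp
        moreover have "- \<gamma> + z \<in> coset H z"
          unfolding coset_def using \<Gamma>(2)[OF d(1)] by blast
        then have "s = coset H (- \<gamma> + z)"
          using coset_eq_iff[OF H] z(2) by blast
        ultimately show "s \<in> coset H ` (visits x \<inter> (C + K))"
          by blast
      qed
      then show ?thesis
        using c[OF x] by (meson card_image_le card_mono finite_imageI finite_subset order_trans)
    qed
    show "if p = \<infinity>
        then \<exists>C::nat. AE x in \<mu>. finite (hitting_times act H (saturation act H Z) x \<inter> L) \<and>
          card (hitting_times act H (saturation act H Z) x \<inter> L) \<le> C
        else (\<integral>\<^sup>+x. cardinality_power (hitting_times act H (saturation act H Z) x \<inter> L) (enn2real p) \<partial>\<mu>) < \<infinity>"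
    proof (cases "p = \<infinity>")
      case True
      then show ?thesis
        using bound by (auto intro!: exI[of _ c] AE_I2)
    next
      case False
      have "(\<integral>\<^sup>+x. cardinality_power (hitting_times act H (saturation act H Z) x \<inter> L) (enn2real p) \<partial>\<mu>)
          \<le> (\<integral>\<^sup>+x. ennreal (real c powr enn2real p) \<partial>\<mu>)"
        using bound by (intro nn_integral_mono) (auto simp: cardinality_power_def intro!: ennreal_leI powr_mono2)
      also have "\<dots> < \<infinity>"
        by (simp add: emeasure_space_1)
      finally show ?thesis
        using False by simp
    qed
  qed
qed

theorem theorem4:
  fixes act :: "'g::{topological_group_add, second_countable_topology, t2_space} \<Rightarrow> 'x \<Rightarrow> 'x"
    and H :: "'g set" and Z :: "'x set" and \<mu> :: "'x measure"
  assumes "locally compact (UNIV :: 'g set)"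
    and "unimodular (UNIV :: 'g set)"
    and "closed_subgroup H"
    and "unimodular H"
    and "separated_transverse_system act Z \<mu>"
  shows "((\<exists>\<Lambda>. compatible_pair H \<Lambda> \<and> return_times act Z \<subseteq> \<Lambda>)
            \<longrightarrow> transverse_integrable act H (saturation act H Z) \<mu> 1)
       \<and> ((\<exists>\<Lambda>. uniform_compatible_pair H \<Lambda> \<and> return_times act Z \<subseteq> \<Lambda>)
            \<longrightarrow> (\<forall>p\<ge>1. transverse_integrable act H (saturation act H Z) \<mu> p))"
  using integrable_if_compatible_pair[OF assms(1,2,3,5)]
    integrable_if_uniform_compatible_pair[OF assms(1,3,5)] by blast

end
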